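(* Let $k\geqslant2$ and let $f$ be a nonnegative $k$-regular sequence. Suppose that $\rho({\bf B})$ is the unique dominant eigenvalue of ${\bf B}$, that $\rho:=\rho({\bf B})>\rho^*(\{{\bf B}_0,\dots,{\bf B}_{k-1}\})$, that $\Sigma(n)\neq0$ for all large $n$, and that the asymptotic behaviour of $\Sigma(n)$ is determined by $\rho$. If $$\prod_{j=0}^{k-1}\|{\bf B}_j\|^{1/k}<\frac{\rho}{k},$$ where $\|\cdot\|$ is the operator norm induced by the Euclidean norm, then the ghost measure of $f$ is purely singular continuous.
   Context: Let $k\geqslant2$. An integer sequence $f=(f(m))_{m\geqslant0}$ is $k$-regular if the $\mathbb Q$-vector space spanned by its $k$-kernel $\{(f(k^\ell n+r))_{n\geqslant0}:\ell\geqslant0,\ 0\leqslant r<k^\ell\}$ is finite-dimensional. Fix a basis $f=f_1,\dots,f_d$ of integer sequences, ${\bf f}(m)=(f_1(m),\dots,f_d(m))$ (row vector); the digit matrices ${\bf B}_0,\dots,{\bf B}_{k-1}\in\mathbb Z^{d\times d}$ satisfy ${\bf f}(km+a)={\bf f}(m){\bf B}_a$ for all $m\geqslant0$, $0\leqslant a<k$; ${\bf B}=\sum_a{\bf B}_a$. $\rho(\cdot)$ is spectral radius; $\rho^*(\{{\bf B}_0,\dots,{\bf B}_{k-1}\})=\limsup_n\max_{i_0,\dots,i_{n-1}}\|{\bf B}_{i_0}\cdots{\bf B}_{i_{n-1}}\|^{1/n}$. "$\rho({\bf B})$ is the unique dominant eigenvalue" means it is a simple eigenvalue and all other eigenvalues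 have strictly smaller modulus. $\Sigma(n)=\sum_{m=k^n}^{k^{n+1}-1}f(m)$; "the asymptotic behaviour of $\Sigma(n)$ is determined by $\rho$" means $\Sigma(n)=c\rho^n(1+o(1))$ for a constant $c\neq0$. $\mu_n=\frac1{\Sigma(n)}\sum_{m=0}^{k^{n+1}-k^n-1}f(k^n+m)\,\delta_{m/(k^n(k-1))}$ on $\mathbb T=[0,1)$; under the hypotheses these converge weakly to a continuous probability measure, the ghost measure of $f$. Purely singular continuous means: no atoms and singular with respect to Lebesgue measure. *)

theory Defs
  imports "Jordan_Normal_Form.Spectral_Radius" "HOL-Probability.Probability"
begin

definition k_kernel :: "nat \<Rightarrow> (nat \<Rightarrow> int) \<Rightarrow> (nat \<Rightarrow> int) set" where
  "k_kernel k f = {(\<lambda>n. f (k ^ l * n + r)) | l r. r < k ^ l}"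

definition qspan :: "(nat \<Rightarrow> int) set \<Rightarrow> (nat \<Rightarrow> rat) set" where
  "qspan S = {g. \<exists>T (c :: (nat \<Rightarrow> int) \<Rightarrow> rat). finite T \<and> T \<subseteq> S \<and>
                    g = (\<lambda>n. \<Sum>s\<in>T. c s * of_int (s n))}"

text \<open>k-regular: the Q-span of the k-kernel is finite-dimensional, i.e. contained in
  (equivalently: a subspace of) the span of finitely many sequences.\<close>
definition k_regular :: "nat \<Rightarrow> (nat \<Rightarrow> int) \<Rightarrow> bool" where
  "k_regular k f \<longleftrightarrow> (\<exists>G. finite G \<and> qspan (k_kernel k f) \<subseteq> qspan G)"

definition q_lin_indep :: "nat \<Rightarrow> (nat \<Rightarrow> nat \<Rightarrow> int) \<Rightarrow> bool" where
  "q_lin_indep d F \<longleftrightarrow>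
     (\<forall>c :: nat \<Rightarrow> rat. (\<forall>m. (\<Sum>i<d. c i * of_int (F i m)) = 0) \<longrightarrow> (\<forall>i<d. c i = 0))"

text \<open>F 0, ..., F (d-1) is a basis of the Q-span of the k-kernel of f, with F 0 = f,
  and B 0, ..., B (k-1) are the corresponding digit matrices:
  f(km+a) = f(m) B_a in row-vector convention.\<close>
definition digit_basis ::
  "nat \<Rightarrow> (nat \<Rightarrow> int) \<Rightarrow> nat \<Rightarrow> (nat \<Rightarrow> nat \<Rightarrow> int) \<Rightarrow> (nat \<Rightarrow> int mat) \<Rightarrow> bool" where
  "digit_basis k f d F B \<longleftrightarrow>
     0 < d \<and> F 0 = f \<and> q_lin_indep d F \<and>
     qspan (F ` {..<d}) = qspan (k_kernel k f) \<and>
     (\<forall>a<k. B a \<in> carrier_mat d d) \<and>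
     (\<forall>m a j. a < k \<longrightarrow> j < d \<longrightarrow>
        F j (k * m + a) = (\<Sum>i<d. F i m * B a $$ (i, j)))"

definition digit_sum :: "nat \<Rightarrow> nat \<Rightarrow> (nat \<Rightarrow> int mat) \<Rightarrow> int mat" where
  "digit_sum k d B = Matrix.mat d d (\<lambda>(i, j). \<Sum>a<k. B a $$ (i, j))"

definition cmat :: "int mat \<Rightarrow> complex mat" where
  "cmat A = map_mat of_int A"

definition rmat :: "int mat \<Rightarrow> real mat" where
  "rmat A = map_mat of_int A"

definition unique_dominant_eigenvalue :: "complex mat \<Rightarrow> bool" where
  "unique_dominant_eigenvalue A \<longleftrightarrow>
     (let r = complex_of_real (spectral_radius A) in
       eigenvalue A r \<and> order r (char_poly A) = 1 \<and>
       (\<forall>z. eigenvalue A z \<longrightarrow> z \<noteq> r \<longrightarrow> cmod z < spectral_radius A))"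

definition vnorm2 :: "real Matrix.vec \<Rightarrow> real" where
  "vnorm2 v = sqrt (\<Sum>i<dim_vec v. (vec_index v i)\<^sup>2)"

definition opnorm2 :: "real mat \<Rightarrow> real" where
  "opnorm2 A = Sup {vnorm2 (A *\<^sub>v x) | x. x \<in> carrier_vec (dim_col A) \<and> vnorm2 x \<le> 1}"

definition word_prod :: "nat \<Rightarrow> (nat \<Rightarrow> real mat) \<Rightarrow> nat list \<Rightarrow> real mat" where
  "word_prod d M w = foldr (\<lambda>i P. M i * P) w (1\<^sub>m d)"

definition joint_spectral_radius :: "nat \<Rightarrow> nat \<Rightarrow> (nat \<Rightarrow> real mat) \<Rightarrow> ereal" where
  "joint_spectral_radius k d M =
     limsup (\<lambda>n. ereal (Max {opnorm2 (word_prod d M w) powr (1 / real n) | w.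
                               length w = n \<and> set w \<subseteq> {..<k}}))"

definition Sigma_sum :: "nat \<Rightarrow> (nat \<Rightarrow> int) \<Rightarrow> nat \<Rightarrow> int" where
  "Sigma_sum k f n = (\<Sum>m\<in>{k ^ n..<k ^ (n + 1)}. f m)"

definition mu_approx_integral :: "nat \<Rightarrow> (nat \<Rightarrow> int) \<Rightarrow> nat \<Rightarrow> (real \<Rightarrow> real) \<Rightarrow> real" where
  "mu_approx_integral k f n g =
     (1 / real_of_int (Sigma_sum k f n)) *
     (\<Sum>m<k ^ (n + 1) - k ^ n. real_of_int (f (k ^ n + m)) *
                              g (real m / (real (k ^ n) * (real k - 1))))"

text \<open>Continuous functions on the torus T = R/Z, viewed as continuous 1-periodic functions.\<close>
definition torus_continuous :: "(real \<Rightarrow> real) \<Rightarrow> bool" where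
  "torus_continuous g \<longleftrightarrow> continuous_on UNIV g \<and> (\<forall>x. g (x + 1) = g x)"

text \<open>Probability measures on T, represented as Borel probability measures on R
  concentrated on [0,1).\<close>
definition torus_prob :: "real measure \<Rightarrow> bool" where
  "torus_prob \<mu> \<longleftrightarrow> sets \<mu> = sets borel \<and> prob_space \<mu> \<and> emeasure \<mu> (- {0..<1}) = 0"

definition ghost_measure :: "nat \<Rightarrow> (nat \<Rightarrow> int) \<Rightarrow> real measure \<Rightarrow> bool" where
  "ghost_measure k f \<mu> \<longleftrightarrow> torus_prob \<mu> \<and>
     (\<forall>g. torus_continuous g \<longrightarrow>
        (\<lambda>n. mu_approx_integral k f n g) \<longlonglongrightarrow> integral\<^sup>L \<mu> g)"

definition purely_singular_continuous :: "real measure \<Rightarrow> bool" where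
  "purely_singular_continuous \<mu> \<longleftrightarrow>
     (\<forall>x. emeasure \<mu> {x} = 0) \<and>
     (\<exists>N \<in> sets borel. emeasure lborel N = 0 \<and> emeasure \<mu> (- N) = 0)"

end

theory Submission
  imports Defs
begin

text \<open>A Schur triangularisation of the digit sum with \<open>\<rho>\<close> in the first diagonal place shows that its
  powers, divided by \<open>\<rho> ^ n\<close> and applied to the first unit vector, converge to a vector \<open>v\<close>.
  With \<open>h M\<close> the product of the row of basis values at \<open>M\<close> with \<open>v\<close>, the approximants give the
  \<open>k\<close>-adic interval of generation \<open>L\<close> and index \<open>M\<close> a mass tending to \<open>h M / (c * \<rho> ^ L)\<close>, so their
  integrals against a continuous function are Cauchy, and Helly's theorem supplies the limit measure.
  Products of \<open>L\<close> digit matrices grow like \<open>r ^ L\<close> with \<open>r < \<rho>\<close>, which excludes atoms.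

  For singularity put \<open>q j = \<parallel>B j\<parallel> * k / \<rho>\<close>, slightly enlarged to be positive while the product of
  all \<open>q j\<close> stays less than 1. Up to a constant, the product \<open>w\<close> of \<open>q\<close> over the last \<open>L\<close> digits of \<open>M\<close>
  bounds the density of the measure on the interval of \<open>M\<close>. For a small exponent \<open>s > 0\<close> the mean of
  \<open>q j powr s\<close> is some \<open>\<theta> < 1\<close>. Hence the intervals with \<open>w \<le> 1\<close> have measure at most a constant
  times \<open>\<theta> ^ L\<close>, those with \<open>w > 1\<close> have Lebesgue measure at most \<open>\<theta> ^ L\<close>, and two applications of
  Borel-Cantelli separate the two measures.\<close>

section \<open>Powers of a matrix with a unique dominant eigenvalue\<close>

text \<open>A strictly smaller rate, rather than mere \<open>o(\<rho> ^ l)\<close>, is what makes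
  errors divided by \<open>\<rho> ^ l\<close> summable.\<close>

definition geometrically_below :: "real \<Rightarrow> (nat \<Rightarrow> complex) \<Rightarrow> bool" where
  "geometrically_below \<rho> x \<longleftrightarrow>
     (\<exists>C r. 0 \<le> C \<and> 0 < r \<and> r < \<rho> \<and> (\<forall>l. cmod (x l) \<le> C * r ^ l))"

lemma geometrically_below_zero: "0 < \<rho> \<Longrightarrow> geometrically_below \<rho> (\<lambda>_. 0)"
  unfolding geometrically_below_def by (intro exI[of _ 0] exI[of _ "\<rho>/2"]) auto

lemma geometrically_below_add:
  assumes "geometrically_below \<rho> x" "geometrically_below \<rho> y"
  shows "geometrically_below \<rho> (\<lambda>l. x l + y l)"
proof -
  obtain C r where 1: "0 \<le> C" "0 < r" "r < \<rho>" "\<And>l. cmod (x l) \<le> C * r ^ l"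
    using assms(1) unfolding geometrically_below_def by blast
  obtain D s where 2: "0 \<le> D" "0 < s" "s < \<rho>" "\<And>l. cmod (y l) \<le> D * s ^ l"
    using assms(2) unfolding geometrically_below_def by blast
  have "cmod (x l + y l) \<le> (C + D) * max r s ^ l" for l
  proof -
    have "cmod (x l + y l) \<le> C * r ^ l + D * s ^ l"
      using 1(4)[of l] 2(4)[of l] norm_triangle_ineq[of "x l" "y l"] by linarith
    also have "\<dots> \<le> C * max r s ^ l + D * max r s ^ l"
      using 1 2 by (intro add_mono mult_left_mono power_mono) auto
    finally show ?thesis by (simp add: algebra_simps)
  qed
  then show ?thesis
    unfolding geometrically_below_def using 1 2
    by (intro exI[of _ "C + D"] exI[of _ "max r s"]) auto
qed

lemma geometrically_below_scale:
  assumes "geometrically_below \<rho> x"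
  shows "geometrically_below \<rho> (\<lambda>l. a * x l)"
proof -
  obtain C r where 1: "0 \<le> C" "0 < r" "r < \<rho>" "\<And>l. cmod (x l) \<le> C * r ^ l"
    using assms unfolding geometrically_below_def by blast
  have "cmod (a * x l) \<le> cmod a * C * r ^ l" for l
    using mult_left_mono[OF 1(4)[of l] norm_ge_zero[of a]] by (simp add: norm_mult mult.assoc)
  then show ?thesis
    unfolding geometrically_below_def using 1
    by (intro exI[of _ "cmod a * C"] exI[of _ r]) auto
qed

lemma geometrically_below_sum:
  assumes "0 < \<rho>" "\<And>i. i \<in> I \<Longrightarrow> geometrically_below \<rho> (x i)"
  shows "geometrically_below \<rho> (\<lambda>l. \<Sum>i\<in>I. a i * x i l)"
  using assms(2)
proof (induction I rule: infinite_finite_induct)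
  case (insert i I)
  then show ?case
    using geometrically_below_add[OF geometrically_below_scale[of \<rho> "x i" "a i"]] by simp
qed (auto simp: geometrically_below_zero assms(1))

text \<open>If \<open>s\<close> is at least the rate of \<open>e\<close> and exceeds
  \<open>cmod a\<close>, the bound \<open>D * s ^ l\<close> reproduces itself under the recurrence
  as soon as \<open>C \<le> D * (s - cmod a)\<close>.\<close>

lemma geometrically_below_recurrence:
  assumes rec: "\<And>l. x (Suc l) = a * x l + e l" and e: "geometrically_below \<rho> e" and a: "cmod a < \<rho>"
  shows "geometrically_below \<rho> x"
proof -
  obtain C r where 1: "0 \<le> C" "0 < r" "r < \<rho>" "\<And>l. cmod (e l) \<le> C * r ^ l"
    using e unfolding geometrically_below_def by blast
  define s where "s = (max r (cmod a) + \<rho>) / 2"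
  have s: "0 < s" "s < \<rho>" "r \<le> s" "cmod a < s" using 1 a unfolding s_def by (auto simp: max_def)
  \<comment> \<open>The first entry starts the induction, the second absorbs the forcing term in
    each step.\<close>
  define D where "D = max (cmod (x 0)) (C / (s - cmod a))"
  have D: "0 \<le> D" "cmod (x 0) \<le> D" "C / (s - cmod a) \<le> D"
    unfolding D_def by (auto simp: le_max_iff_disj)
  then have D': "C \<le> D * (s - cmod a)" using s by (simp add: pos_divide_le_eq)
  have "cmod (x l) \<le> D * s ^ l" for l
  proof (induction l)
    case (Suc l)
    have "cmod (x (Suc l)) \<le> cmod a * cmod (x l) + cmod (e l)"
      unfolding rec by (metis norm_triangle_ineq norm_mult)
    also have "\<dots> \<le> cmod a * (D * s ^ l) + C * s ^ l"
      using 1 s Suc order_trans[OF 1(4)[of l] mult_left_mono[OF power_mono[of r s l] 1(1)]]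
      by (intro add_mono mult_left_mono) auto
    also have "\<dots> \<le> cmod a * (D * s ^ l) + D * (s - cmod a) * s ^ l"
      using D' s by (intro add_mono mult_right_mono order_refl) auto
    also have "\<dots> = D * s ^ Suc l" by (simp add: algebra_simps)
    finally show ?case .
  qed (use D in simp)
  then show ?thesis
    unfolding geometrically_below_def using D s by blast
qed

text \<open>The increments of \<open>x l / \<rho> ^ l\<close> are
  \<open>e l / \<rho> ^ Suc l\<close>, dominated by a geometric series of ratio
  \<open>r / \<rho>\<close>; they telescope.\<close>

lemma convergent_dominant_recurrence:
  assumes rec: "\<And>l. x (Suc l) = of_real \<rho> * x l + e l" and e: "geometrically_below \<rho> e" and "0 < \<rho>"
  shows "convergent (\<lambda>l. x l / of_real \<rho> ^ l)"
proof -
  obtain C r where 1: "0 \<le> C" "0 < r" "r < \<rho>" "\<And>l. cmod (e l) \<le> C * r ^ l"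
    using e unfolding geometrically_below_def by blast
  let ?y = "\<lambda>l. x l / of_real \<rho> ^ l"
  have diff: "?y (Suc l) - ?y l = e l / of_real \<rho> ^ Suc l" for l
    unfolding rec using \<open>0 < \<rho>\<close> by (simp add: field_simps)
  have "summable (\<lambda>l. ?y (Suc l) - ?y l)"
  proof (rule summable_comparison_test')
    show "summable (\<lambda>l. C / \<rho> * (r / \<rho>) ^ l)"
      using 1 by (intro summable_mult summable_geometric) auto
    show "norm (?y (Suc l) - ?y l) \<le> C / \<rho> * (r / \<rho>) ^ l" if "l \<ge> 0" for l
      unfolding diff using 1(4)[of l] \<open>0 < \<rho>\<close>
      by (simp add: norm_divide norm_power norm_mult power_divide divide_simps)
  qed
  then have "convergent (\<lambda>n. \<Sum>l<n. ?y (Suc l) - ?y l)"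
    by (simp add: summable_iff_convergent)
  then have "convergent (\<lambda>n. ?y n - ?y 0)"
    unfolding sum_lessThan_telescope[of ?y] .
  then show ?thesis
    using convergent_add[OF _ convergent_const[of "?y 0"]] by fastforce
qed

text \<open>Back substitution: each coordinate after the first has a multiplier of modulus below
  \<rho> and is driven by later coordinates only, so it stays geometrically below \<rho>. The first
  coordinate is then a geometric sequence of ratio \<rho> with a summable relative error.\<close>

lemma upper_triangular_power_convergent:
  fixes T :: "nat \<Rightarrow> nat \<Rightarrow> complex"
  assumes rec: "\<And>l i. i < n \<Longrightarrow> y (Suc l) i = (\<Sum>j<n. T i j * y l j)"
    and tri: "\<And>i j. j < i \<Longrightarrow> i < n \<Longrightarrow> T i j = 0"
    and dom: "T 0 0 = of_real \<rho>" and rest: "\<And>i. 0 < i \<Longrightarrow> i < n \<Longrightarrow> cmod (T i i) < \<rho>"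
    and "0 < \<rho>" and i: "i < n"
  shows "convergent (\<lambda>l. y l i / of_real \<rho> ^ l)"
proof -
  have row: "y (Suc l) i = T i i * y l i + (\<Sum>j\<in>{i<..<n}. T i j * y l j)" if "i < n" for i l
  proof -
    have "(\<Sum>j<n. T i j * y l j) = (\<Sum>j\<in>{i..<n}. T i j * y l j)"
      using tri that by (intro sum.mono_neutral_right) auto
    also have "{i..<n} = insert i {i<..<n}" using that by auto
    finally show ?thesis using rec[OF that] by simp
  qed
  have below: "geometrically_below \<rho> (\<lambda>l. y l i)" if "0 < i" "i < n" for i
    using that
  \<comment> \<open>The induction runs from the last row upwards.\<close>
  proof (induction "n - i" arbitrary: i rule: less_induct)
    case less
    have "geometrically_below \<rho> (\<lambda>l. \<Sum>j\<in>{i<..<n}. T i j * y l j)"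
      using less by (intro geometrically_below_sum \<open>0 < \<rho>\<close>) auto
    then show ?case
      by (rule geometrically_below_recurrence[where x = "\<lambda>l. y l i" and a = "T i i", OF row[OF less.prems(2)] _ rest[OF less.prems]])
  qed
  have conv0: "convergent (\<lambda>l. y l 0 / of_real \<rho> ^ l)"
  proof (rule convergent_dominant_recurrence)
    show "y (Suc l) 0 = of_real \<rho> * y l 0 + (\<Sum>j\<in>{0<..<n}. T 0 j * y l j)" for l
      using row[of 0] i dom by simp
    show "geometrically_below \<rho> (\<lambda>l. \<Sum>j\<in>{0<..<n}. T 0 j * y l j)"
      using below by (intro geometrically_below_sum \<open>0 < \<rho>\<close>) auto
  qed fact
  show ?thesis
  proof (cases "i = 0")
    case False
    then obtain C r where 1: "0 \<le> C" "0 < r" "r < \<rho>" "\<And>l. cmod (y l i) \<le> C * r ^ l"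
      using below[of i] i unfolding geometrically_below_def by blast
    have "(\<lambda>l. y l i / of_real \<rho> ^ l) \<longlonglongrightarrow> 0"
    proof (rule tendsto_0_le)
      show "(\<lambda>l. (r / \<rho>) ^ l) \<longlonglongrightarrow> 0"
        using 1 by (intro LIMSEQ_power_zero) auto
      show "\<forall>\<^sub>F l in sequentially. norm (y l i / of_real \<rho> ^ l) \<le> norm ((r / \<rho>) ^ l) * C"
        using 1 \<open>0 < \<rho>\<close>
        by (intro always_eventually allI) (simp add: norm_divide norm_power power_divide divide_simps mult.commute)
    qed
    then show ?thesis by (auto simp: convergent_def)
  qed (use conv0 in simp)
qed

text \<open>Since the dominant root is simple, deleting one copy from the list of roots deletes it
  altogether. It is put in front because the Schur decomposition keeps the order of the list on the
  diagonal.\<close>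

lemma unique_dominant_factorization:
  fixes A :: "complex mat"
  assumes A: "A \<in> carrier_mat n n" and dom: "unique_dominant_eigenvalue A"
  obtains es where "char_poly A = (\<Prod>e\<leftarrow>complex_of_real (spectral_radius A) # es. [:- e, 1:])"
    "\<And>e. e \<in> set es \<Longrightarrow> cmod e < spectral_radius A"
proof -
  let ?r = "complex_of_real (spectral_radius A)"
  have ev: "eigenvalue A ?r" and ord: "order ?r (char_poly A) = 1"
    and less: "\<And>z. eigenvalue A z \<Longrightarrow> z \<noteq> ?r \<Longrightarrow> cmod z < spectral_radius A"
    using dom unfolding unique_dominant_eigenvalue_def Let_def by auto
  obtain as where as: "char_poly A = (\<Prod>a\<leftarrow>as. [:- a, 1:])"
    using char_poly_factorized[OF A] by blast
  have roots: "poly (\<Prod>a\<leftarrow>bs. [:- a, 1:]) z = 0 \<longleftrightarrow> z \<in> set bs" for bs and z :: complex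
    by (induction bs) auto
  have mem: "?r \<in> set as"
    using ev roots unfolding eigenvalue_root_char_poly[OF A] as by blast
  define es where "es = remove1 ?r as"
  have fac: "char_poly A = [:- ?r, 1:] * (\<Prod>a\<leftarrow>es. [:- a, 1:])"
    unfolding as es_def using prod_list_map_remove1[OF mem, of "\<lambda>a. [:- a, 1:]"] by simp
  have nz: "char_poly A \<noteq> 0" using degree_monic_char_poly[OF A] by auto
  have "?r \<notin> set es"
  proof
    assume "?r \<in> set es"
    then have "[:- ?r, 1:] dvd (\<Prod>a\<leftarrow>es. [:- a, 1:])"
      using roots by (simp add: poly_eq_0_iff_dvd[symmetric])
    then have "[:- ?r, 1:] ^ 2 dvd char_poly A"
      unfolding fac power2_eq_square by (rule mult_dvd_mono[OF dvd_refl])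
    then have "2 \<le> order ?r (char_poly A)" by (rule order_max[OF _ nz])
    then show False using ord by simp
  qed
  moreover have "eigenvalue A e" if "e \<in> set es" for e
    unfolding eigenvalue_root_char_poly[OF A] fac using roots that by auto
  ultimately have "\<And>e. e \<in> set es \<Longrightarrow> cmod e < spectral_radius A"
    using less by metis
  then show ?thesis using that[of es] fac by simp
qed

lemma mult_mat_vec_index_sum:
  assumes "A \<in> carrier_mat n m" "x \<in> carrier_vec m" "i < n"
  shows "vec_index (A *\<^sub>v x) i = (\<Sum>j<m. A $$ (i, j) * vec_index x j)"
  using assms by (auto simp: scalar_prod_def lessThan_atLeast0 intro!: sum.cong)

text \<open>In the Schur coordinates \<open>Q *\<^sub>v w l\<close> the iteration is triangular with
  the dominant eigenvalue first; \<open>P\<close> carries the convergence back to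
  \<open>w\<close>.\<close>

lemma unique_dominant_power_convergent:
  fixes A :: "complex mat"
  assumes A: "A \<in> carrier_mat n n" and dom: "unique_dominant_eigenvalue A"
    and pos: "0 < spectral_radius A"
    and w: "\<And>l. w l \<in> carrier_vec n" "\<And>l. w (Suc l) = A *\<^sub>v w l" and i: "i < n"
  shows "convergent (\<lambda>l. vec_index (w l) i / of_real (spectral_radius A) ^ l)"
proof -
  let ?r = "spectral_radius A"
  obtain es where es: "char_poly A = (\<Prod>e\<leftarrow>complex_of_real ?r # es. [:- e, 1:])"
    "\<And>e. e \<in> set es \<Longrightarrow> cmod e < ?r"
    using unique_dominant_factorization[OF A dom] by metis
  obtain T P Q where "schur_decomposition A (complex_of_real ?r # es) = (T, P, Q)"
    by (cases "schur_decomposition A (complex_of_real ?r # es)") auto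
  from schur_decomposition[OF A es(1) this]
  have sim: "similar_mat_wit A T P Q" and tri: "upper_triangular T"
    and diag: "diag_mat T = complex_of_real ?r # es" by auto
  have c: "T \<in> carrier_mat n n" "P \<in> carrier_mat n n" "Q \<in> carrier_mat n n"
    and PQ: "P * Q = 1\<^sub>m n" "Q * P = 1\<^sub>m n" and eq: "A = P * T * Q"
    using sim A unfolding similar_mat_wit_def Let_def by auto
  define y where "y l = Q *\<^sub>v w l" for l
  have yc: "y l \<in> carrier_vec n" for l unfolding y_def using c w by auto
  have wy: "w l = P *\<^sub>v y l" for l
    unfolding y_def using assoc_mult_mat_vec[OF c(2,3) w(1)] PQ w(1) by simp
  have ySuc: "y (Suc l) = T *\<^sub>v y l" for l
  proof -
    have "y (Suc l) = Q *\<^sub>v (A *\<^sub>v w l)" unfolding y_def w ..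
    also have "A *\<^sub>v w l = P *\<^sub>v (T *\<^sub>v y l)"
      unfolding eq y_def using c w(1) by (simp add: assoc_mult_mat_vec[where n\<^sub>1=n and n\<^sub>2=n and n\<^sub>3=n])
    also have "Q *\<^sub>v (P *\<^sub>v (T *\<^sub>v y l)) = T *\<^sub>v y l"
      using assoc_mult_mat_vec[OF c(3,2), of "T *\<^sub>v y l"] c yc[of l] PQ by simp
    finally show ?thesis .
  qed
  have Tdiag: "T $$ (j, j) = (complex_of_real ?r # es) ! j" if "j < n" for j
    using arg_cong[OF diag, of "\<lambda>xs. xs ! j"] c that unfolding diag_mat_def by simp
  have len: "length es = n - 1"
    using arg_cong[OF diag, of length] c i unfolding diag_mat_def by simp
  have conv: "convergent (\<lambda>l. vec_index (y l) j / of_real ?r ^ l)" if "j < n" for j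
  proof (rule upper_triangular_power_convergent[where n = n and T = "\<lambda>i j. T $$ (i, j)"])
    show "vec_index (y (Suc l)) a = (\<Sum>b<n. T $$ (a, b) * vec_index (y l) b)" if "a < n" for a l
      unfolding ySuc by (rule mult_mat_vec_index_sum[OF c(1) yc that])
    show "T $$ (a, b) = 0" if "b < a" "a < n" for a b
      using tri c that unfolding upper_triangular_def by auto
    show "T $$ (0, 0) = complex_of_real ?r" using Tdiag[of 0] i by simp
    show "cmod (T $$ (a, a)) < ?r" if "0 < a" "a < n" for a
      using Tdiag[of a] that len es(2)[of "es ! (a - 1)"] by simp
  qed (use pos that in auto)
  have "convergent (\<lambda>l. \<Sum>j<n. P $$ (i, j) * (vec_index (y l) j / of_real ?r ^ l))"
    using conv by (intro convergent_sum convergent_mult convergent_const) auto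
  also have "(\<lambda>l. \<Sum>j<n. P $$ (i, j) * (vec_index (y l) j / of_real ?r ^ l))
      = (\<lambda>l. vec_index (w l) i / of_real ?r ^ l)"
    unfolding wy mult_mat_vec_index_sum[OF c(2) yc i] by (simp add: sum_divide_distrib)
  finally show ?thesis .
qed

section \<open>Operator norms and digit systems\<close>

lemma sum_blocks:
  fixes \<phi> :: "nat \<Rightarrow> 'a::comm_monoid_add"
  assumes "a \<le> b"
  shows "(\<Sum>M\<in>{a..<b}. \<Sum>r<q. \<phi> (q * M + r)) = (\<Sum>M\<in>{q * a..<q * b}. \<phi> M)"
  using assms
proof (induction rule: dec_induct)
  case (step n)
  have "(\<Sum>M\<in>{q * a..<q * Suc n}. \<phi> M)
      = (\<Sum>M\<in>{q * a..<q * n}. \<phi> M) + (\<Sum>M\<in>{q * n..<q * n + q}. \<phi> M)"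
    using step sum.atLeastLessThan_concat[of "q * a" "q * n" "q * Suc n" \<phi>] by (simp add: add.commute)
  also have "(\<Sum>M\<in>{q * n..<q * n + q}. \<phi> M) = (\<Sum>r<q. \<phi> (q * n + r))"
    using sum.shift_bounds_nat_ivl[of \<phi> 0 "q * n" q] by (simp add: add.commute lessThan_atLeast0)
  finally show ?case using step by simp
qed simp

section \<open>Euclidean norm and operator norm\<close>

lemma vnorm2_eq_L2_set: "vnorm2 v = L2_set (vec_index v) {..<dim_vec v}"
  unfolding vnorm2_def L2_set_def ..

lemma vnorm2_nonneg: "0 \<le> vnorm2 v"
  unfolding vnorm2_def by (simp add: sum_nonneg)

lemma vnorm2_smult: "vnorm2 (c \<cdot>\<^sub>v v) = \<bar>c\<bar> * vnorm2 v"
  unfolding vnorm2_def by (simp add: power_mult_distrib sum_distrib_left[symmetric] real_sqrt_mult)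

lemma vnorm2_eq_0_imp:
  assumes "vnorm2 v = 0" shows "v = 0\<^sub>v (dim_vec v)"
proof -
  have "\<forall>i\<in>{..<dim_vec v}. (vec_index v i)\<^sup>2 = 0"
    using assms unfolding vnorm2_def by (subst sum_nonneg_eq_0_iff[symmetric]) auto
  then show ?thesis by auto
qed

text \<open>A real supremum is informative only for a bounded set; the sum of the absolute values of
  all entries is a crude but sufficient bound.\<close>

lemma opnorm2_bdd_above:
  "bdd_above {vnorm2 (A *\<^sub>v x) | x. x \<in> carrier_vec (dim_col A) \<and> vnorm2 x \<le> 1}"
proof (rule bdd_aboveI, clarify)
  fix x :: "real Matrix.vec" assume x: "x \<in> carrier_vec (dim_col A)" "vnorm2 x \<le> 1"
  have le1: "\<bar>vec_index x j\<bar> \<le> 1" if "j < dim_col A" for j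
  proof -
    have "\<bar>vec_index x j\<bar> \<le> vnorm2 x"
      using member_le_L2_set[of "{..<dim_vec x}" j "\<lambda>i. \<bar>vec_index x i\<bar>"] x that
      by (simp add: vnorm2_eq_L2_set L2_set_def)
    then show ?thesis using x(2) by (rule order_trans)
  qed
  have "vnorm2 (A *\<^sub>v x) \<le> (\<Sum>i<dim_row A. \<bar>vec_index (A *\<^sub>v x) i\<bar>)"
    unfolding vnorm2_eq_L2_set using L2_set_le_sum_abs[of "vec_index (A *\<^sub>v x)"]
    by (simp del: index_mult_mat_vec)
  also have "\<dots> \<le> (\<Sum>i<dim_row A. \<Sum>j<dim_col A. \<bar>A $$ (i, j)\<bar>)"
  proof (rule sum_mono)
    fix i assume "i \<in> {..<dim_row A}"
    then have "vec_index (A *\<^sub>v x) i = (\<Sum>j<dim_col A. A $$ (i, j) * vec_index x j)"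
      using x by (intro mult_mat_vec_index_sum[of A "dim_row A"]) auto
    also have "\<bar>\<dots>\<bar> \<le> (\<Sum>j<dim_col A. \<bar>A $$ (i, j) * vec_index x j\<bar>)" by (rule sum_abs)
    also have "\<dots> \<le> (\<Sum>j<dim_col A. \<bar>A $$ (i, j)\<bar>)"
      using le1 by (intro sum_mono) (auto simp: abs_mult intro: mult_left_le)
    finally show "\<bar>vec_index (A *\<^sub>v x) i\<bar> \<le> (\<Sum>j<dim_col A. \<bar>A $$ (i, j)\<bar>)" .
  qed
  finally show "vnorm2 (A *\<^sub>v x) \<le> (\<Sum>i<dim_row A. \<Sum>j<dim_col A. \<bar>A $$ (i, j)\<bar>)" .
qed

lemma opnorm2_nonneg: "0 \<le> opnorm2 A"
proof -
  have "vnorm2 (A *\<^sub>v 0\<^sub>v (dim_col A)) \<le> opnorm2 A"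
    unfolding opnorm2_def
    by (intro cSup_upper opnorm2_bdd_above CollectI exI[of _ "0\<^sub>v (dim_col A)"]) (simp add: vnorm2_def)
  then show ?thesis using vnorm2_nonneg order_trans by blast
qed

lemma vnorm2_mult_mat_vec_le:
  assumes x: "x \<in> carrier_vec (dim_col A)"
  shows "vnorm2 (A *\<^sub>v x) \<le> opnorm2 A * vnorm2 x"
proof (cases "vnorm2 x = 0")
  case True
  then have "x = 0\<^sub>v (dim_col A)" using vnorm2_eq_0_imp[of x] x by simp
  then have "A *\<^sub>v x = 0\<^sub>v (dim_row A)" by auto
  then have "vnorm2 (A *\<^sub>v x) = 0" by (simp add: vnorm2_def)
  then show ?thesis using True by simp
next
  case False
  define t where "t = vnorm2 x"
  have t: "0 < t" using False vnorm2_nonneg[of x] unfolding t_def by simp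
  \<comment> \<open>The supremum ranges over the unit ball, so \<open>x\<close> is normalised
    first.\<close>
  have "vnorm2 (A *\<^sub>v ((1 / t) \<cdot>\<^sub>v x)) \<le> opnorm2 A"
    unfolding opnorm2_def using x t
    by (intro cSup_upper opnorm2_bdd_above CollectI exI[of _ "(1 / t) \<cdot>\<^sub>v x"])
       (auto simp: vnorm2_smult t_def[symmetric])
  also have "A *\<^sub>v ((1 / t) \<cdot>\<^sub>v x) = (1 / t) \<cdot>\<^sub>v (A *\<^sub>v x)"
    using x by (intro mult_mat_vec[of A "dim_row A" "dim_col A"]) auto
  finally show ?thesis using t by (simp add: vnorm2_smult t_def[symmetric] field_simps)
qed

section \<open>Products of digit matrices along words\<close>

lemma word_prod_carrier:
  assumes "\<And>a. a < k \<Longrightarrow> M a \<in> carrier_mat d d" "set w \<subseteq> {..<k}"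
  shows "word_prod d M w \<in> carrier_mat d d"
  using assms(2) by (induction w) (auto simp: word_prod_def intro: mult_carrier_mat assms(1))

text \<open>\<open>foldr\<close> unfolds a word from the front, whereas the digits of an index are
  peeled off at the end.\<close>

lemma word_prod_snoc:
  assumes "\<And>a. a < k \<Longrightarrow> M a \<in> carrier_mat d d" "set w \<subseteq> {..<k}" "a < k"
  shows "word_prod d M (w @ [a]) = word_prod d M w * M a"
  using assms(2)
proof (induction w)
  case Nil
  then show ?case using assms(1)[OF assms(3)] by (simp add: word_prod_def)
next
  case (Cons b w)
  have "word_prod d M (b # w @ [a]) = M b * word_prod d M (w @ [a])"
    and "word_prod d M (b # w) = M b * word_prod d M w" by (simp_all add: word_prod_def)
  then show ?case
    using Cons assms(1,3) word_prod_carrier[of k M d w]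
    by (auto simp: assoc_mult_mat[where n\<^sub>1 = d and n\<^sub>2 = d and n\<^sub>3 = d and n\<^sub>4 = d])
qed

text \<open>A rate strictly between the limsup and \<rho> eventually dominates the maximum, hence
  every single word of length \<open>n\<close>.\<close>

lemma joint_spectral_radius_lessD:
  assumes "joint_spectral_radius k d M < ereal \<rho>" "0 < \<rho>"
  obtains r where "0 < r" "r < \<rho>"
    "\<forall>\<^sub>F n in sequentially. \<forall>w. length w = n \<longrightarrow> set w \<subseteq> {..<k} \<longrightarrow> opnorm2 (word_prod d M w) \<le> r ^ n"
proof -
  \<comment> \<open>The maximum with 0 keeps the chosen rate positive.\<close>
  have "max (ereal 0) (joint_spectral_radius k d M) < ereal \<rho>" using assms by simp
  then obtain r where r: "max (ereal 0) (joint_spectral_radius k d M) < ereal r" "ereal r < ereal \<rho>"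
    using ereal_dense2 by blast
  then have r0: "0 < r" "r < \<rho>" "joint_spectral_radius k d M < ereal r" by auto
  have "\<forall>\<^sub>F n in sequentially. ereal (Max {opnorm2 (word_prod d M w) powr (1 / real n) | w.
      length w = n \<and> set w \<subseteq> {..<k}}) < ereal r"
    using r0(3) unfolding joint_spectral_radius_def by (rule Limsup_lessD)
  then have "\<forall>\<^sub>F n in sequentially. \<forall>w. length w = n \<longrightarrow> set w \<subseteq> {..<k} \<longrightarrow> opnorm2 (word_prod d M w) \<le> r ^ n"
    using eventually_gt_at_top[of 0]
  proof eventually_elim
    case (elim n)
    show ?case
    proof (intro allI impI)
      fix w :: "nat list" assume w: "length w = n" "set w \<subseteq> {..<k}"
      let ?S = "{opnorm2 (word_prod d M w) powr (1 / real n) | w. length w = n \<and> set w \<subseteq> {..<k}}"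
      have "?S = (\<lambda>w. opnorm2 (word_prod d M w) powr (1 / real n)) ` {w. set w \<subseteq> {..<k} \<and> length w = n}"
        by auto
      then have "finite ?S" by (simp add: finite_lists_length_eq)
      then have "opnorm2 (word_prod d M w) powr (1 / real n) \<le> Max ?S"
        using w by (intro Max_ge) auto
      then have le: "opnorm2 (word_prod d M w) powr (1 / real n) \<le> r" using elim by simp
      \<comment> \<open>Undoing the root needs \<open>n > 0\<close>; norm 0 is treated apart because
        \<open>powr_realpow\<close> asks for a positive base.\<close>
      have "opnorm2 (word_prod d M w) = (opnorm2 (word_prod d M w) powr (1 / real n)) ^ n"
      proof (cases "opnorm2 (word_prod d M w) = 0")
        case False
        then have "0 < opnorm2 (word_prod d M w)" using opnorm2_nonneg[of "word_prod d M w"] by simp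
        then show ?thesis using elim by (simp add: powr_realpow[symmetric] powr_powr)
      qed (use elim in simp)
      also have "\<dots> \<le> r ^ n" using le by (intro power_mono) auto
      finally show "opnorm2 (word_prod d M w) \<le> r ^ n" .
    qed
  qed
  then show ?thesis using that r0 by blast
qed

section \<open>Products of weights over base-\<open>k\<close> digits\<close>

fun digit_weight :: "nat \<Rightarrow> (nat \<Rightarrow> real) \<Rightarrow> nat \<Rightarrow> nat \<Rightarrow> real" where
  "digit_weight k q 0 M = 1"
| "digit_weight k q (Suc L) M = q (M mod k) * digit_weight k q L (M div k)"

lemma digit_weight_nonneg:
  assumes "2 \<le> k" "\<And>j. j < k \<Longrightarrow> 0 \<le> q j" shows "0 \<le> digit_weight k q L M"
  using assms by (induction L arbitrary: M) auto

lemma digit_weight_powr: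
  assumes "2 \<le> k" "\<And>j. j < k \<Longrightarrow> 0 \<le> q j"
  shows "digit_weight k q L M powr s = digit_weight k (\<lambda>j. q j powr s) L M"
  using assms by (induction L arbitrary: M) (auto simp: powr_mult digit_weight_nonneg)

lemma digit_weight_mono:
  assumes "2 \<le> k" "\<And>j. j < k \<Longrightarrow> 0 \<le> p j \<and> p j \<le> q j"
  shows "digit_weight k p L M \<le> digit_weight k q L M"
proof (induction L arbitrary: M)
  case (Suc L)
  have q0: "0 \<le> q j" if "j < k" for j using assms(2)[OF that] by linarith
  have "M mod k < k" using assms(1) by simp
  with Suc.IH show ?case
    using assms q0 by (auto intro!: mult_mono digit_weight_nonneg)
qed simp

lemma digit_weight_scale:
  "digit_weight k (\<lambda>j. a * q j) L M = a ^ L * digit_weight k q L M"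
  by (induction L arbitrary: M) (auto simp: mult_ac)

text \<open>Appending a digit multiplies the sum by \<open>\<Sum>j<k. q j\<close>, while the leading
  part still runs through \<open>a..<b\<close>. With \<open>a = 1\<close> and \<open>b = k\<close>
  the range is that of all numbers with \<open>L + 1\<close> digits.\<close>

lemma sum_digit_weight:
  assumes "2 \<le> k" "a \<le> b"
  shows "(\<Sum>M\<in>{k ^ L * a..<k ^ L * b}. digit_weight k q L M) = real (b - a) * (\<Sum>j<k. q j) ^ L"
proof (induction L)
  case (Suc L)
  have "(\<Sum>M\<in>{k ^ Suc L * a..<k ^ Suc L * b}. digit_weight k q (Suc L) M)
      = (\<Sum>M\<in>{k ^ L * a..<k ^ L * b}. \<Sum>j<k. digit_weight k q (Suc L) (k * M + j))"
    using sum_blocks[of "k ^ L * a" "k ^ L * b" "digit_weight k q (Suc L)" k] assms by (simp add: mult_ac)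
  also have "\<dots> = (\<Sum>M\<in>{k ^ L * a..<k ^ L * b}. (\<Sum>j<k. q j) * digit_weight k q L M)"
    using assms by (simp add: sum_distrib_right)
  also have "\<dots> = real (b - a) * (\<Sum>j<k. q j) ^ Suc L"
    by (simp add: sum_distrib_left[symmetric] Suc.IH)
  finally show ?case .
qed simp

definition block_sum :: "nat \<Rightarrow> (nat \<Rightarrow> int) \<Rightarrow> nat \<Rightarrow> nat \<Rightarrow> real" where
  "block_sum k f l M = (\<Sum>r<k ^ l. real_of_int (f (k ^ l * M + r)))"

section \<open>Rows of basis values under the digit matrices\<close>

locale digit_system =
  fixes k d :: nat and F :: "nat \<Rightarrow> nat \<Rightarrow> int" and B :: "nat \<Rightarrow> int mat"
  assumes k2: "2 \<le> k"
    and carrier: "a < k \<Longrightarrow> B a \<in> carrier_mat d d"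
    and recurrence: "a < k \<Longrightarrow> j < d \<Longrightarrow> F j (k * m + a) = (\<Sum>i<d. F i m * B a $$ (i, j))"
begin

definition row_val :: "nat \<Rightarrow> real Matrix.vec \<Rightarrow> real" where
  "row_val m x = (\<Sum>i<d. real_of_int (F i m) * vec_index x i)"

definition row_norm :: "nat \<Rightarrow> real" where
  "row_norm m = L2_set (\<lambda>i. real_of_int (F i m)) {..<d}"

lemma row_norm_nonneg: "0 \<le> row_norm m"
  unfolding row_norm_def by (rule L2_set_nonneg)

lemma rmat_carrier: "a < k \<Longrightarrow> rmat (B a) \<in> carrier_mat d d"
  using carrier unfolding rmat_def by simp

lemma digit_sum_carrier: "digit_sum k d B \<in> carrier_mat d d"
  unfolding digit_sum_def by simp

lemma row_val_le:
  assumes "x \<in> carrier_vec d" shows "\<bar>row_val m x\<bar> \<le> row_norm m * vnorm2 x"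
proof -
  have "\<bar>row_val m x\<bar> \<le> (\<Sum>i<d. \<bar>real_of_int (F i m)\<bar> * \<bar>vec_index x i\<bar>)"
    unfolding row_val_def by (rule order_trans[OF sum_abs]) (simp add: abs_mult)
  also have "\<dots> \<le> row_norm m * vnorm2 x"
    unfolding row_norm_def vnorm2_eq_L2_set using assms L2_set_mult_ineq by auto
  finally show ?thesis .
qed

lemma row_val_rmat:
  assumes A: "A \<in> carrier_mat d d" and x: "x \<in> carrier_vec d"
  shows "row_val m (rmat A *\<^sub>v x)
    = (\<Sum>j<d. (\<Sum>i<d. real_of_int (F i m) * real_of_int (A $$ (i, j))) * vec_index x j)"
proof -
  have c: "rmat A \<in> carrier_mat d d" using A unfolding rmat_def by simp
  have "row_val m (rmat A *\<^sub>v x)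
      = (\<Sum>i<d. \<Sum>j<d. real_of_int (F i m) * real_of_int (A $$ (i, j)) * vec_index x j)"
    unfolding row_val_def
  proof (intro sum.cong refl)
    fix i assume "i \<in> {..<d}"
    then have i: "i < d" by simp
    show "real_of_int (F i m) * vec_index (rmat A *\<^sub>v x) i
        = (\<Sum>j<d. real_of_int (F i m) * real_of_int (A $$ (i, j)) * vec_index x j)"
      unfolding mult_mat_vec_index_sum[OF c x i] sum_distrib_left
      using A i by (intro sum.cong) (auto simp: rmat_def)
  qed
  also have "\<dots> = (\<Sum>j<d. \<Sum>i<d. real_of_int (F i m) * real_of_int (A $$ (i, j)) * vec_index x j)"
    by (rule sum.swap)
  finally show ?thesis by (simp add: sum_distrib_right)
qed

lemma row_val_digit:
  assumes a: "a < k" and x: "x \<in> carrier_vec d"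
  shows "row_val (k * m + a) x = row_val m (rmat (B a) *\<^sub>v x)"
  unfolding row_val_rmat[OF carrier[OF a] x] unfolding row_val_def using recurrence[OF a] by simp

lemma row_val_div_mod:
  assumes "x \<in> carrier_vec d"
  shows "row_val M x = row_val (M div k) (rmat (B (M mod k)) *\<^sub>v x)"
  using row_val_digit[of "M mod k" x "M div k"] assms k2 by simp

lemma sum_row_val_digit:
  assumes x: "x \<in> carrier_vec d"
  shows "(\<Sum>a<k. row_val (k * m + a) x) = row_val m (rmat (digit_sum k d B) *\<^sub>v x)"
proof -
  have "(\<Sum>a<k. row_val (k * m + a) x)
      = (\<Sum>a<k. \<Sum>j<d. (\<Sum>i<d. real_of_int (F i m) * real_of_int (B a $$ (i, j))) * vec_index x j)"
    by (intro sum.cong refl) (simp add: row_val_digit[OF _ x] row_val_rmat[OF carrier x])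
  also have "\<dots> = (\<Sum>j<d. \<Sum>a<k. \<Sum>i<d. real_of_int (F i m) * real_of_int (B a $$ (i, j)) * vec_index x j)"
    by (subst sum.swap) (simp add: sum_distrib_right)
  also have "\<dots> = (\<Sum>j<d. \<Sum>i<d. \<Sum>a<k. real_of_int (F i m) * real_of_int (B a $$ (i, j)) * vec_index x j)"
    by (intro sum.cong refl sum.swap)
  also have "\<dots> = row_val m (rmat (digit_sum k d B) *\<^sub>v x)"
    unfolding row_val_rmat[OF digit_sum_carrier x]
    by (intro sum.cong refl) (simp add: digit_sum_def sum_distrib_left sum_distrib_right)
  finally show ?thesis .
qed

text \<open>Summing over the last digit first replaces \<open>x\<close> by its image under the digit
  sum, so \<open>x\<close> varies in the induction. The iterated map stands for the matrix
  power.\<close>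

lemma sum_row_val_block:
  assumes "x \<in> carrier_vec d"
  shows "(\<Sum>r<k ^ l. row_val (k ^ l * m + r) x) = row_val m (((*\<^sub>v) (rmat (digit_sum k d B)) ^^ l) x)"
  using assms
proof (induction l arbitrary: x)
  case (Suc l)
  have c: "rmat (digit_sum k d B) *\<^sub>v x \<in> carrier_vec d"
    using digit_sum_carrier Suc.prems unfolding rmat_def by auto
  have "(\<Sum>r<k ^ Suc l. row_val (k ^ Suc l * m + r) x)
      = (\<Sum>r<k ^ l. \<Sum>a<k. row_val (k ^ Suc l * m + (k * r + a)) x)"
    using sum_blocks[of 0 "k ^ l" "\<lambda>r. row_val (k ^ Suc l * m + r) x" k] by (simp add: lessThan_atLeast0)
  also have "\<dots> = (\<Sum>r<k ^ l. \<Sum>a<k. row_val (k * (k ^ l * m + r) + a) x)"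
    by (simp add: algebra_simps)
  also have "\<dots> = (\<Sum>r<k ^ l. row_val (k ^ l * m + r) (rmat (digit_sum k d B) *\<^sub>v x))"
    by (simp add: sum_row_val_digit[OF Suc.prems])
  also have "\<dots> = row_val m (((*\<^sub>v) (rmat (digit_sum k d B)) ^^ Suc l) x)"
    by (simp add: Suc.IH[OF c] funpow_swap1)
  finally show ?case .
qed simp

text \<open>Each of the last \<open>L\<close> digits of \<open>M\<close> moves its matrix onto the
  vector and costs one operator norm; the row at the prefix \<open>M div k ^ L\<close>
  remains.\<close>

lemma row_val_digit_weight_le:
  assumes "x \<in> carrier_vec d"
  shows "\<bar>row_val M x\<bar> \<le> row_norm (M div k ^ L) * digit_weight k (\<lambda>j. opnorm2 (rmat (B j))) L M * vnorm2 x"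
  using assms
proof (induction L arbitrary: M x)
  case 0
  then show ?case using row_val_le by simp
next
  case (Suc L)
  let ?b = "\<lambda>j. opnorm2 (rmat (B j))" and ?A = "rmat (B (M mod k))"
  have A: "?A \<in> carrier_mat d d" using k2 by (intro rmat_carrier) simp
  have wnn: "0 \<le> digit_weight k ?b L m" for m
    by (induction L arbitrary: m) (auto simp: opnorm2_nonneg)
  have "\<bar>row_val M x\<bar> = \<bar>row_val (M div k) (?A *\<^sub>v x)\<bar>"
    using row_val_div_mod[OF Suc.prems] by metis
  also have "\<dots> \<le> row_norm (M div k div k ^ L) * digit_weight k ?b L (M div k) * vnorm2 (?A *\<^sub>v x)"
    using A Suc.prems by (intro Suc.IH) auto
  also have "\<dots> \<le> row_norm (M div k div k ^ L) * digit_weight k ?b L (M div k) * (?b (M mod k) * vnorm2 x)"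
    using A Suc.prems by (intro mult_left_mono vnorm2_mult_mat_vec_le) (auto intro!: mult_nonneg_nonneg wnn row_norm_nonneg)
  finally show ?case by (simp add: div_mult2_eq mult_ac)
qed

text \<open>The same peeling, but with the product kept whole so that the joint spectral radius can
  bound it. The last digit acts on \<open>x\<close> first and therefore ends the word.\<close>

lemma row_val_word_prod:
  assumes "x \<in> carrier_vec d"
  shows "\<exists>w. length w = L \<and> set w \<subseteq> {..<k} \<and>
    row_val M x = row_val (M div k ^ L) (word_prod d (\<lambda>a. rmat (B a)) w *\<^sub>v x)"
  using assms
proof (induction L arbitrary: M x)
  case 0
  then show ?case by (simp add: word_prod_def)
next
  case (Suc L)
  let ?W = "word_prod d (\<lambda>a. rmat (B a))" and ?A = "rmat (B (M mod k))"
  have a: "M mod k < k" using k2 by simp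
  have A: "?A \<in> carrier_mat d d" by (rule rmat_carrier[OF a])
  obtain w where w: "length w = L" "set w \<subseteq> {..<k}"
    "row_val (M div k) (?A *\<^sub>v x) = row_val (M div k div k ^ L) (?W w *\<^sub>v (?A *\<^sub>v x))"
    using Suc.IH[of "?A *\<^sub>v x" "M div k"] A Suc.prems by auto
  have W: "?W w \<in> carrier_mat d d" using w by (intro word_prod_carrier rmat_carrier) auto
  have "?W (w @ [M mod k]) = ?W w * ?A"
    using rmat_carrier w(2) a by (intro word_prod_snoc) auto
  then have "?W w *\<^sub>v (?A *\<^sub>v x) = ?W (w @ [M mod k]) *\<^sub>v x"
    by (simp only: assoc_mult_mat_vec[OF W A Suc.prems])
  then show ?case
    using w a row_val_div_mod[OF Suc.prems, of M]
    by (intro exI[of _ "w @ [M mod k]"]) (simp add: div_mult2_eq)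
qed

text \<open>Applied to the first unit vector, the row at \<open>m\<close> gives
  \<open>F 0 m\<close>. Block sums are thus rows applied to powers of the digit sum at that vector,
  whose rescaled coordinates converge.\<close>

lemma block_sum_limit:
  assumes d: "0 < d" and dom: "unique_dominant_eigenvalue (cmat (digit_sum k d B))"
    and pos: "0 < spectral_radius (cmat (digit_sum k d B))"
  obtains v where "v \<in> carrier_vec d"
    "\<And>M. (\<lambda>l. block_sum k (F 0) l M / spectral_radius (cmat (digit_sum k d B)) ^ l) \<longlonglongrightarrow> row_val M v"
proof -
  let ?D = "digit_sum k d B"
  let ?r = "spectral_radius (cmat ?D)"
  let ?e = "unit_vec d 0 :: real Matrix.vec"
  define w where "w l = ((*\<^sub>v) (rmat ?D) ^^ l) ?e" for l
  have D: "rmat ?D \<in> carrier_mat d d" "cmat ?D \<in> carrier_mat d d"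
    using digit_sum_carrier unfolding rmat_def cmat_def by auto
  have wc: "w l \<in> carrier_vec d" for l
    using D by (induction l) (auto simp: w_def)
  have wS: "w (Suc l) = rmat ?D *\<^sub>v w l" for l by (simp add: w_def)
  \<comment> \<open>The spectral argument is complex: the real iterates are embedded, and real parts
    of the limits are taken afterwards.\<close>
  define u where "u l = map_vec complex_of_real (w l)" for l
  have uc: "u l \<in> carrier_vec d" for l using wc unfolding u_def by simp
  have uS: "u (Suc l) = cmat ?D *\<^sub>v u l" for l
  proof (rule eq_vecI)
    fix i assume "i < dim_vec (cmat ?D *\<^sub>v u l)"
    then have i: "i < d" using D by simp
    have "vec_index (u (Suc l)) i = complex_of_real (\<Sum>j<d. rmat ?D $$ (i, j) * vec_index (w l) j)"
      using wc[of "Suc l"] i mult_mat_vec_index_sum[OF D(1) wc[of l] i] by (simp add: u_def wS[symmetric])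
    then show "vec_index (u (Suc l)) i = vec_index (cmat ?D *\<^sub>v u l) i"
      unfolding mult_mat_vec_index_sum[OF D(2) uc i]
      using i wc[of l] digit_sum_carrier by (simp add: u_def rmat_def cmat_def)
  qed (use uc D in \<open>simp add: carrier_vecD\<close>)
  have "convergent (\<lambda>l. vec_index (w l) i / ?r ^ l)" if i: "i < d" for i
  proof -
    obtain z where "(\<lambda>l. vec_index (u l) i / of_real ?r ^ l) \<longlonglongrightarrow> z"
      using unique_dominant_power_convergent[where w = u, OF D(2) dom pos uc uS i] unfolding convergent_def by blast
    then have "(\<lambda>l. Re (vec_index (u l) i / of_real ?r ^ l)) \<longlonglongrightarrow> Re z" by (rule tendsto_Re)
    moreover have "Re (vec_index (u l) i / of_real ?r ^ l) = vec_index (w l) i / ?r ^ l" for l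
      using i wc[of l] by (simp add: u_def flip: of_real_power of_real_divide)
    ultimately show ?thesis unfolding convergent_def by auto
  qed
  then have "\<forall>i. \<exists>z. i < d \<longrightarrow> (\<lambda>l. vec_index (w l) i / ?r ^ l) \<longlonglongrightarrow> z"
    unfolding convergent_def by blast
  then obtain v where v: "\<And>i. i < d \<Longrightarrow> (\<lambda>l. vec_index (w l) i / ?r ^ l) \<longlonglongrightarrow> v i" by metis
  have "(\<lambda>l. block_sum k (F 0) l M / ?r ^ l) \<longlonglongrightarrow> row_val M (Matrix.vec d v)" for M
  proof -
    have "row_val m ?e = real_of_int (F 0 m)" for m
      using d by (simp add: row_val_def unit_vec_def if_distrib[of "(*) _"] cong: if_cong)
    then have "block_sum k (F 0) l M = row_val M (w l)" for l
      using sum_row_val_block[of ?e l M] by (simp add: block_sum_def w_def)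
    then have "(\<lambda>l. block_sum k (F 0) l M / ?r ^ l)
        = (\<lambda>l. \<Sum>i<d. real_of_int (F i M) * (vec_index (w l) i / ?r ^ l))"
      by (simp add: row_val_def sum_divide_distrib)
    also have "\<dots> \<longlonglongrightarrow> (\<Sum>i<d. real_of_int (F i M) * v i)"
      using v by (intro tendsto_sum tendsto_mult tendsto_const) auto
    finally show ?thesis by (simp add: row_val_def)
  qed
  then show ?thesis using that[of "Matrix.vec d v"] by simp
qed

text \<open>Below \<open>k ^ Suc L\<close> the prefix \<open>M div k ^ L\<close> is a single digit,
  so only \<open>k\<close> rows occur.\<close>

lemma row_norm_bound: "\<exists>C\<ge>0. \<forall>L M. M < k ^ Suc L \<longrightarrow> row_norm (M div k ^ L) \<le> C"
proof (intro exI[of _ "\<Sum>m<k. row_norm m"] conjI allI impI)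
  fix L M :: nat assume "M < k ^ Suc L"
  then have "M div k ^ L < k" using k2 by (simp add: less_mult_imp_div_less)
  then show "row_norm (M div k ^ L) \<le> (\<Sum>m<k. row_norm m)"
    using row_norm_nonneg by (intro member_le_sum) auto
qed (simp add: sum_nonneg row_norm_nonneg)

end

section \<open>Interval masses and existence of the ghost measure\<close>

lemma torus_continuous_bounded:
  assumes "torus_continuous g"
  obtains C where "\<And>x. \<bar>g x\<bar> \<le> C"
proof -
  have "compact (g ` {0..1})"
    using assms unfolding torus_continuous_def
    by (intro compact_continuous_image) (auto intro: continuous_on_subset)
  then have "bounded (g ` {0..1})" by (rule compact_imp_bounded)
  then obtain C where C: "\<forall>y\<in>g ` {0..1}. norm y \<le> C" unfolding bounded_iff ..
  have shift: "g (x + of_nat n) = g x" for x n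
  proof (induction n)
    case (Suc n)
    have "g (x + of_nat n + 1) = g (x + of_nat n)" using assms unfolding torus_continuous_def by blast
    then show ?case using Suc by (simp add: algebra_simps)
  qed simp
  have ishift: "g (x + of_int n) = g x" for x n
    using shift[of x "nat n"] shift[of "x + of_int n" "nat (- n)"] by (cases "0 \<le> n") auto
  have "\<bar>g x\<bar> \<le> C" for x
    using bspec[OF C, of "g (frac x)"] ishift[of "frac x" "\<lfloor>x\<rfloor>"] frac_lt_1[of x] frac_ge_0[of x]
    by (simp add: frac_def)
  then show ?thesis using that by blast
qed

text \<open>The comparison sequence may depend on the tolerance, as it does when a function is
  replaced by step functions of finer and finer generation.\<close>

lemma convergent_if_approximable:
  fixes x :: "nat \<Rightarrow> real"
  assumes "\<And>e. 0 < e \<Longrightarrow> \<exists>s. convergent s \<and> (\<forall>\<^sub>F n in sequentially. \<bar>x n - s n\<bar> \<le> e)"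
  shows "convergent x"
proof (rule Cauchy_convergent, rule metric_CauchyI)
  fix e :: real assume e: "0 < e"
  obtain s where s: "convergent s" "\<forall>\<^sub>F n in sequentially. \<bar>x n - s n\<bar> \<le> e / 4"
    using assms[of "e / 4"] e by auto
  obtain N where N: "\<And>n. n \<ge> N \<Longrightarrow> \<bar>x n - s n\<bar> \<le> e / 4"
    using s(2) unfolding eventually_sequentially by blast
  obtain N' where N': "\<And>m n. m \<ge> N' \<Longrightarrow> n \<ge> N' \<Longrightarrow> \<bar>s m - s n\<bar> < e / 4"
    using convergent_Cauchy[OF s(1)] e unfolding Cauchy_def dist_real_def
    by (metis divide_pos_pos zero_less_numeral)
  show "\<exists>M. \<forall>m\<ge>M. \<forall>n\<ge>M. dist (x m) (x n) < e"
  proof (intro exI[of _ "max N N'"] allI impI)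
    fix m n assume "max N N' \<le> m" "max N N' \<le> n"
    then show "dist (x m) (x n) < e"
      using N[of m] N[of n] N'[of m n] e unfolding dist_real_def by (simp add: abs_if split: if_splits)
  qed
qed

text \<open>Matrices enter only through the limits \<open>h M\<close>, so the measure theory is done
  for an abstract \<open>h\<close>.\<close>

locale ghost_limit =
  fixes k :: nat and f :: "nat \<Rightarrow> int" and \<rho> c :: real and h :: "nat \<Rightarrow> real"
  assumes k2: "2 \<le> k" and nonneg: "0 \<le> f m" and \<rho>_pos: "0 < \<rho>" and c_pos: "0 < c"
    and block_lim: "(\<lambda>l. block_sum k f l M / \<rho> ^ l) \<longlonglongrightarrow> h M"
    and Sigma_lim: "(\<lambda>n. real_of_int (Sigma_sum k f n) / \<rho> ^ n) \<longlonglongrightarrow> c"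
begin

definition level :: "nat \<Rightarrow> nat set" where "level L = {k ^ L..<k ^ Suc L}"

text \<open>An index \<open>M\<close> in \<open>level L\<close> stands for the interval from \<open>pos L M\<close> to \<open>pos L (Suc M)\<close>; its
  subintervals in generation \<open>L + j\<close> have the indices \<open>k ^ j * M + r\<close> with \<open>r < k ^ j\<close>.\<close>

definition pos :: "nat \<Rightarrow> nat \<Rightarrow> real" where
  "pos L M = (real M / real k ^ L - 1) / (real k - 1)"

text \<open>The limiting share of \<open>Sigma_sum\<close> carried by the descendants of
  \<open>M\<close>. It will bound a ghost measure on the open interval of \<open>M\<close> from
  above.\<close>

definition mass :: "nat \<Rightarrow> nat \<Rightarrow> real" where "mass L M = h M / (c * \<rho> ^ L)"

section \<open>Geometry of the \<open>k\<close>-adic intervals\<close>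

lemma finite_level: "finite (level L)" unfolding level_def by simp

lemma pos_less_iff: "pos L M < pos L N \<longleftrightarrow> M < N"
  using k2 unfolding pos_def by (simp add: divide_less_cancel)

lemma pos_le_iff: "pos L M \<le> pos L N \<longleftrightarrow> M \<le> N"
  using pos_less_iff[of L N M] by linarith

lemma pos_start: "pos L (k ^ L) = 0" and pos_end: "pos L (k ^ Suc L) = 1"
  using k2 unfolding pos_def by auto

lemma pos_level: "M \<in> level L \<Longrightarrow> 0 \<le> pos L M \<and> pos L M < 1 \<and> pos L (Suc M) \<le> 1"
  using pos_le_iff[of L "k ^ L" M] pos_less_iff[of L M "k ^ Suc L"] pos_le_iff[of L "Suc M" "k ^ Suc L"]
  unfolding level_def pos_start pos_end by auto

lemma pos_width: "pos L (Suc M) - pos L M = 1 / (real k ^ L * (real k - 1))"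
  using k2 unfolding pos_def by (simp add: field_simps)

lemma pos_descendant:
  assumes "r < k ^ j"
  shows "pos L M \<le> pos (L + j) (k ^ j * M + r)" "pos (L + j) (k ^ j * M + r) < pos L (Suc M)"
proof -
  have eq: "pos (L + j) (k ^ j * N) = pos L N" for N
    using k2 unfolding pos_def by (simp add: power_add)
  show "pos L M \<le> pos (L + j) (k ^ j * M + r)" unfolding eq[of M, symmetric] pos_le_iff by simp
  show "pos (L + j) (k ^ j * M + r) < pos L (Suc M)"
    unfolding eq[of "Suc M", symmetric] pos_less_iff using assms by simp
qed

section \<open>Approximants and their block masses\<close>

lemma Sigma_pos: "\<forall>\<^sub>F n in sequentially. 0 < Sigma_sum k f n"
proof -
  have "\<forall>\<^sub>F n in sequentially. 0 < real_of_int (Sigma_sum k f n) / \<rho> ^ n"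
    using order_tendstoD(1)[OF Sigma_lim c_pos] .
  then show ?thesis by eventually_elim (use \<rho>_pos in \<open>simp add: zero_less_divide_iff\<close>)
qed

lemma mu_approx_eq:
  "mu_approx_integral k f n g =
     (\<Sum>M\<in>level n. real_of_int (f M) * g (pos n M)) / real_of_int (Sigma_sum k f n)"
proof -
  have "(\<Sum>m<k ^ (n + 1) - k ^ n. real_of_int (f (k ^ n + m)) * g (real m / (real (k ^ n) * (real k - 1))))
      = (\<Sum>M\<in>level n. real_of_int (f M) * g (pos n M))"
  proof (rule sum.reindex_bij_witness[where j = "\<lambda>m. k ^ n + m" and i = "\<lambda>M. M - k ^ n"])
    fix m
    have "real m / (real (k ^ n) * (real k - 1)) = pos n (k ^ n + m)"
      using k2 by (simp add: pos_def field_simps)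
    then show "real_of_int (f (k ^ n + m)) * g (pos n (k ^ n + m))
        = real_of_int (f (k ^ n + m)) * g (real m / (real (k ^ n) * (real k - 1)))" by simp
  qed (auto simp: level_def)
  then show ?thesis unfolding mu_approx_integral_def by simp
qed

lemma sum_level_add:
  fixes \<phi> :: "nat \<Rightarrow> real"
  shows "(\<Sum>M\<in>level (L + j). \<phi> M) = (\<Sum>M\<in>level L. \<Sum>r<k ^ j. \<phi> (k ^ j * M + r))"
  using sum_blocks[of "k ^ L" "k ^ Suc L" \<phi> "k ^ j"] k2
  unfolding level_def by (simp add: power_add mult_ac)

lemma Sigma_blocks: "real_of_int (Sigma_sum k f (L + j)) = (\<Sum>M\<in>level L. block_sum k f j M)"
  using sum_level_add[of "\<lambda>M. real_of_int (f M)" L j]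
  unfolding Sigma_sum_def block_sum_def level_def by simp

lemma mass_lim: "(\<lambda>j. block_sum k f j M / real_of_int (Sigma_sum k f (L + j))) \<longlonglongrightarrow> mass L M"
proof -
  have "(\<lambda>j. real_of_int (Sigma_sum k f (L + j)) / \<rho> ^ (L + j)) \<longlonglongrightarrow> c"
    using LIMSEQ_ignore_initial_segment[OF Sigma_lim, of L] by (simp add: add.commute)
  then have "(\<lambda>j. (block_sum k f j M / \<rho> ^ j) / (real_of_int (Sigma_sum k f (L + j)) / \<rho> ^ (L + j)) / \<rho> ^ L)
      \<longlonglongrightarrow> h M / c / \<rho> ^ L"
    using c_pos \<rho>_pos by (intro tendsto_divide block_lim tendsto_const) auto
  then show ?thesis using \<rho>_pos by (simp add: mass_def power_add)
qed

text \<open>In generation \<open>L + j\<close> only descendants of \<open>Z\<close> contribute to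
  the approximating integral, and \<open>g \<le> 1\<close> bounds them by block sums.
  \<open>L\<close> stays fixed while \<open>j\<close> grows.\<close>

lemma ghost_integral_le:
  assumes ghost: "ghost_measure k f \<mu>" and g: "torus_continuous g" "\<And>y. 0 \<le> g y" "\<And>y. g y \<le> 1"
    and Z: "Z \<subseteq> level L"
    and vanish: "\<And>M y. M \<in> level L - Z \<Longrightarrow> pos L M \<le> y \<Longrightarrow> y < pos L (Suc M) \<Longrightarrow> g y = 0"
  shows "integral\<^sup>L \<mu> g \<le> (\<Sum>M\<in>Z. mass L M)"
proof (rule tendsto_le[OF sequentially_bot])
  show "(\<lambda>j. mu_approx_integral k f (L + j) g) \<longlonglongrightarrow> integral\<^sup>L \<mu> g"
    using LIMSEQ_ignore_initial_segment[of "\<lambda>n. mu_approx_integral k f n g" _ L] ghost g(1)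
    unfolding ghost_measure_def by (simp add: add.commute)
  show "(\<lambda>j. \<Sum>M\<in>Z. block_sum k f j M / real_of_int (Sigma_sum k f (L + j))) \<longlonglongrightarrow> (\<Sum>M\<in>Z. mass L M)"
    by (intro tendsto_sum mass_lim)
  have le: "(\<Sum>r<k ^ j. real_of_int (f (k ^ j * M + r)) * g (pos (L + j) (k ^ j * M + r))) \<le> block_sum k f j M" for j M
    unfolding block_sum_def using g nonneg by (intro sum_mono) (auto intro: mult_left_le)
  have zero: "(\<Sum>r<k ^ j. real_of_int (f (k ^ j * M + r)) * g (pos (L + j) (k ^ j * M + r))) = 0"
    if "M \<in> level L - Z" for j M
    using vanish[OF that] pos_descendant by (intro sum.neutral) auto
  have "(\<Sum>M\<in>level (L + j). real_of_int (f M) * g (pos (L + j) M)) \<le> (\<Sum>M\<in>Z. block_sum k f j M)" for j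
  proof -
    have "(\<Sum>M\<in>level (L + j). real_of_int (f M) * g (pos (L + j) M))
        = (\<Sum>M\<in>Z. \<Sum>r<k ^ j. real_of_int (f (k ^ j * M + r)) * g (pos (L + j) (k ^ j * M + r)))"
      unfolding sum_level_add using zero Z by (intro sum.mono_neutral_right finite_level) auto
    also have "\<dots> \<le> (\<Sum>M\<in>Z. block_sum k f j M)" by (intro sum_mono le)
    finally show ?thesis .
  qed
  then have "mu_approx_integral k f (L + j) g \<le> (\<Sum>M\<in>Z. block_sum k f j M / real_of_int (Sigma_sum k f (L + j)))"
    if "0 < Sigma_sum k f (L + j)" for j
    unfolding mu_approx_eq using that by (simp add: sum_divide_distrib[symmetric] divide_right_mono)
  moreover have "\<forall>\<^sub>F j in sequentially. 0 < Sigma_sum k f (L + j)"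
    using Sigma_pos eventually_sequentially_seg[of "\<lambda>n. 0 < Sigma_sum k f n" L] by (simp add: add.commute)
  ultimately show "\<forall>\<^sub>F j in sequentially. mu_approx_integral k f (L + j) g
      \<le> (\<Sum>M\<in>Z. block_sum k f j M / real_of_int (Sigma_sum k f (L + j)))"
    by (auto elim: eventually_mono)
qed

text \<open>On each interval of a fixed generation \<open>L\<close>, \<open>g\<close> is replaced by
  its value at the left endpoint. The resulting sums converge by \<open>mass_lim\<close>, and
  uniform continuity bounds the error by \<open>e\<close> in all late generations.\<close>

lemma mu_approx_convergent:
  assumes g: "torus_continuous g"
  shows "convergent (\<lambda>n. mu_approx_integral k f n g)"
proof (rule convergent_if_approximable)
  fix e :: real assume e: "0 < e"
  have "uniformly_continuous_on {0..1} g"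
    using g unfolding torus_continuous_def
    by (intro compact_uniformly_continuous) (auto intro: continuous_on_subset)
  then obtain \<delta> where \<delta>: "0 < \<delta>"
    "\<And>x y. x \<in> {0..1} \<Longrightarrow> y \<in> {0..1} \<Longrightarrow> \<bar>y - x\<bar> < \<delta> \<Longrightarrow> \<bar>g y - g x\<bar> < e"
    using e unfolding uniformly_continuous_on_def dist_real_def by metis
  obtain L where "(1 / real k) ^ L < \<delta>"
    using real_arch_pow_inv[OF \<delta>(1), of "1 / real k"] k2 by auto
  moreover have "1 / (real k ^ L * (real k - 1)) \<le> (1 / real k) ^ L"
    using k2 by (simp add: power_divide divide_simps)
  ultimately have width: "pos L (Suc M) - pos L M < \<delta>" for M unfolding pos_width by linarith
  define s where "s j = (\<Sum>M\<in>level L. g (pos L M) * (block_sum k f j M / real_of_int (Sigma_sum k f (L + j))))" for j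
  have "convergent s"
    unfolding s_def using mass_lim
    by (intro convergent_sum convergent_mult convergent_const) (auto simp: convergent_def)
  then obtain l where "s \<longlonglongrightarrow> l" unfolding convergent_def by blast
  \<comment> \<open>\<open>s\<close> counts generations after \<open>L\<close>; the truncated
    subtraction only affects \<open>n < L\<close>.\<close>
  then have "(\<lambda>n. s (n - L)) \<longlonglongrightarrow> l" using LIMSEQ_offset[of "\<lambda>n. s (n - L)" L l] by simp
  then have 1: "convergent (\<lambda>n. s (n - L))" unfolding convergent_def by blast
  have close: "\<bar>mu_approx_integral k f (L + j) g - s j\<bar> \<le> e" if S: "0 < Sigma_sum k f (L + j)" for j
  proof -
    let ?S = "real_of_int (Sigma_sum k f (L + j))" and ?p = "\<lambda>M r. k ^ j * M + r"
    have eq: "mu_approx_integral k f (L + j) g - s j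
        = (\<Sum>M\<in>level L. \<Sum>r<k ^ j. real_of_int (f (?p M r)) * (g (pos (L + j) (?p M r)) - g (pos L M))) / ?S"
      unfolding mu_approx_eq s_def sum_level_add block_sum_def
      by (simp add: algebra_simps sum_subtractf sum_distrib_left sum_divide_distrib diff_divide_distrib)
    have "\<bar>mu_approx_integral k f (L + j) g - s j\<bar>
        \<le> (\<Sum>M\<in>level L. \<Sum>r<k ^ j. real_of_int (f (?p M r)) * e) / ?S"
    proof -
      have "\<bar>real_of_int (f (?p M r)) * (g (pos (L + j) (?p M r)) - g (pos L M))\<bar> \<le> real_of_int (f (?p M r)) * e"
        if M: "M \<in> level L" and r: "r < k ^ j" for M r
      proof -
        note d = pos_descendant[OF r, of L M] and w = width[of M] and b = pos_level[OF M]
        have "\<bar>g (pos (L + j) (?p M r)) - g (pos L M)\<bar> < e"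
          using d w b by (intro \<delta>(2)) auto
        then show ?thesis using nonneg by (simp add: abs_mult mult_left_mono)
      qed
      then have "\<bar>\<Sum>M\<in>level L. \<Sum>r<k ^ j. real_of_int (f (?p M r)) * (g (pos (L + j) (?p M r)) - g (pos L M))\<bar>
          \<le> (\<Sum>M\<in>level L. \<Sum>r<k ^ j. real_of_int (f (?p M r)) * e)"
        by (intro order_trans[OF sum_abs] sum_mono) (auto intro!: order_trans[OF sum_abs] sum_mono)
      then show ?thesis unfolding eq using S by (simp add: abs_divide divide_right_mono)
    qed
    also have "(\<Sum>M\<in>level L. \<Sum>r<k ^ j. real_of_int (f (?p M r)) * e) = ?S * e"
      unfolding Sigma_blocks block_sum_def by (simp add: sum_distrib_right)
    finally show ?thesis using S by simp
  qed
  have "\<forall>\<^sub>F n in sequentially. \<bar>mu_approx_integral k f n g - s (n - L)\<bar> \<le> e"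
    using Sigma_pos eventually_ge_at_top[of L]
  proof eventually_elim
    case (elim n)
    then show ?case using close[of "n - L"] by simp
  qed
  with 1 show "\<exists>s. convergent s \<and> (\<forall>\<^sub>F n in sequentially. \<bar>mu_approx_integral k f n g - s n\<bar> \<le> e)"
    by (intro exI[of _ "\<lambda>n. s (n - L)"] conjI)
qed

section \<open>Existence of the limit measure by Helly's theorem\<close>

definition mu_approx :: "nat \<Rightarrow> real measure" where
  "mu_approx n = distr (point_measure (level n) (\<lambda>M. ennreal (real_of_int (f M) / real_of_int (Sigma_sum k f n)))) borel (pos n)"

lemma integral_mu_approx:
  assumes "0 < Sigma_sum k f n" and [measurable]: "g \<in> borel_measurable borel"
  shows "integral\<^sup>L (mu_approx n) g = mu_approx_integral k f n g"
proof -
  let ?N = "point_measure (level n) (\<lambda>M. ennreal (real_of_int (f M) / real_of_int (Sigma_sum k f n)))"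
  have "pos n \<in> measurable ?N borel" by (simp add: point_measure_def)
  then have "integral\<^sup>L (mu_approx n) g = integral\<^sup>L ?N (\<lambda>M. g (pos n M))"
    unfolding mu_approx_def by (rule integral_distr) measurable
  also have "\<dots> = (\<Sum>M\<in>level n. (real_of_int (f M) / real_of_int (Sigma_sum k f n)) *\<^sub>R g (pos n M))"
    using assms(1) nonneg by (intro lebesgue_integral_point_measure_finite finite_level) simp
  finally show ?thesis unfolding mu_approx_eq by (simp add: sum_divide_distrib)
qed

lemma real_distribution_mu_approx:
  assumes S: "0 < Sigma_sum k f n"
  shows "real_distribution (mu_approx n)"
proof -
  let ?N = "point_measure (level n) (\<lambda>M. ennreal (real_of_int (f M) / real_of_int (Sigma_sum k f n)))"
  have "emeasure ?N (space ?N) = (\<Sum>M\<in>level n. ennreal (real_of_int (f M) / real_of_int (Sigma_sum k f n)))"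
    by (simp add: space_point_measure emeasure_point_measure_finite finite_level)
  also have "\<dots> = ennreal (\<Sum>M\<in>level n. real_of_int (f M) / real_of_int (Sigma_sum k f n))"
    using S nonneg by (intro sum_ennreal) auto
  also have "(\<Sum>M\<in>level n. real_of_int (f M) / real_of_int (Sigma_sum k f n)) = 1"
    using S by (simp add: sum_divide_distrib[symmetric] Sigma_sum_def level_def flip: of_int_sum)
  finally interpret prob_space ?N by (intro prob_spaceI) simp
  show ?thesis unfolding mu_approx_def by (rule real_distribution_distr) (simp add: point_measure_def)
qed

lemma AE_mu_approx: "AE x in mu_approx n. x \<in> {0..1}"
proof -
  have "AE x in point_measure (level n) (\<lambda>M. ennreal (real_of_int (f M) / real_of_int (Sigma_sum k f n))).
      pos n x \<in> {0..1}"
    by (rule AE_I2) (use pos_level[of _ n] in \<open>force simp: space_point_measure\<close>)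
  then show ?thesis
    unfolding mu_approx_def by (subst AE_distr_iff) (auto simp: point_measure_def)
qed

lemma tight_mu_approx:
  assumes "\<And>n. 0 < Sigma_sum k f (n + N)"
  shows "tight (\<lambda>n. mu_approx (n + N))"
proof (unfold tight_def, intro conjI allI impI)
  fix e :: real assume "0 < e"
  \<comment> \<open>The window in the definition of tightness is open on the left and has to contain
    0, hence the left end -1.\<close>
  have "measure (mu_approx (n + N)) {-1<..1} = 1" for n
  proof -
    interpret real_distribution "mu_approx (n + N)" using assms by (rule real_distribution_mu_approx)
    show ?thesis
      using AE_mu_approx[of "n + N"] by (subst prob_eq_1) (auto elim: AE_mp)
  qed
  then show "\<exists>a b. a < b \<and> (\<forall>n. 1 - e < measure (mu_approx (n + N)) {a<..b})"
    using \<open>0 < e\<close> by (intro exI[of _ "-1"] exI[of _ 1]) auto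
qed (use assms real_distribution_mu_approx in auto)

text \<open>Helly's theorem yields a weak limit along a subsequence only. Integrals along the whole
  sequence converge by \<open>mu_approx_convergent\<close>, so the subsequence identifies their
  limits.\<close>

theorem ghost_measure_exists: "\<exists>\<mu>. ghost_measure k f \<mu>"
proof -
  \<comment> \<open>The shift by \<open>N\<close> makes every member of the sequence a probability
    measure.\<close>
  obtain N where N: "\<And>n. 0 < Sigma_sum k f (n + N)"
    using Sigma_pos unfolding eventually_sequentially by (meson le_add2)
  obtain r M where r: "strict_mono (r :: nat \<Rightarrow> nat)" and M: "real_distribution M"
    and weak: "weak_conv_m ((\<lambda>n. mu_approx (n + N)) \<circ> id \<circ> r) M"
    using tight_imp_convergent_subsubsequence[OF tight_mu_approx[OF N] strict_mono_id] by blast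
  interpret M: real_distribution M by (rule M)
  have dist: "real_distribution (((\<lambda>n. mu_approx (n + N)) \<circ> id \<circ> r) n)" for n
    using real_distribution_mu_approx[OF N] by simp
  have lim: "(\<lambda>n. integral\<^sup>L (mu_approx (r n + N)) g) \<longlonglongrightarrow> integral\<^sup>L M g"
    if "continuous_on UNIV g" "\<And>x. \<bar>g x\<bar> \<le> C" for g :: "real \<Rightarrow> real" and C
    using weak_conv_imp_integral_bdd_continuous_conv[OF dist M weak, of g C] that
    by (simp add: continuous_on_eq_continuous_at)
  have AE01: "AE x in M. x \<in> {0..1}"
  proof -
    \<comment> \<open>A bounded continuous function vanishing exactly on the unit interval, so that
      its zero integrals pass to the weak limit.\<close>
    define g :: "real \<Rightarrow> real" where "g x = min 1 (max 0 (max (- x) (x - 1)))" for x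
    have gc: "continuous_on UNIV g" unfolding g_def by (intro continuous_intros)
    have gb: "0 \<le> g x" "g x \<le> 1" for x unfolding g_def by auto
    have [measurable]: "g \<in> borel_measurable borel" by (rule borel_measurable_continuous_onI[OF gc])
    have "integral\<^sup>L (mu_approx n) g = 0" for n
      using AE_mu_approx[of n] by (intro integral_eq_zero_AE) (auto elim!: AE_mp simp: g_def)
    then have "integral\<^sup>L M g = 0"
      using lim[OF gc, of 1] gb by (simp add: LIMSEQ_const_iff)
    moreover have "integrable M g" using gb by (intro M.integrable_const_bound[of _ 1]) auto
    ultimately have "AE x in M. g x = 0" using gb by (subst (asm) integral_nonneg_eq_0_iff_AE) auto
    then show ?thesis by (rule AE_mp) (auto simp: g_def min_def max_def split: if_splits)
  qed
  \<comment> \<open>The weak limit may charge 1, which is the point 0 of the torus. Moving that mass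
    to 0 changes no integral of a periodic function.\<close>
  define \<tau> :: "real \<Rightarrow> real" where "\<tau> x = (if x = 1 then 0 else x)" for x
  have [measurable]: "\<tau> \<in> borel_measurable borel" unfolding \<tau>_def by measurable
  have "AE x in M. \<tau> x \<in> {0..<1}" using AE01 by (rule AE_mp) (auto simp: \<tau>_def)
  then have "AE x in distr M borel \<tau>. x \<in> {0..<1}" by (subst AE_distr_iff) auto
  then have "emeasure (distr M borel \<tau>) (- {0..<1}) = 0"
    by (subst (asm) AE_iff_measurable[OF _ refl]) (auto simp: Compl_eq)
  then have "torus_prob (distr M borel \<tau>)"
    unfolding torus_prob_def by (auto intro: M.prob_space_distr)
  moreover have "(\<lambda>n. mu_approx_integral k f n g) \<longlonglongrightarrow> integral\<^sup>L (distr M borel \<tau>) g"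
    if g: "torus_continuous g" for g
  proof -
    obtain l where l: "(\<lambda>n. mu_approx_integral k f n g) \<longlonglongrightarrow> l"
      using mu_approx_convergent[OF g] unfolding convergent_def by blast
    have gc: "continuous_on UNIV g" using g unfolding torus_continuous_def by blast
    have [measurable]: "g \<in> borel_measurable borel" by (rule borel_measurable_continuous_onI[OF gc])
    obtain C where C: "\<And>x. \<bar>g x\<bar> \<le> C" using torus_continuous_bounded[OF g] by metis
    have "(\<lambda>n. mu_approx_integral k f (r n + N) g) \<longlonglongrightarrow> integral\<^sup>L M g"
      using lim[OF gc C] by (simp add: integral_mu_approx[OF N])
    moreover have "(\<lambda>n. mu_approx_integral k f (r n + N) g) \<longlonglongrightarrow> l"
      using LIMSEQ_subseq_LIMSEQ[OF LIMSEQ_ignore_initial_segment[OF l, of N] r] by (simp add: o_def)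
    ultimately have "l = integral\<^sup>L M g" by (metis LIMSEQ_unique)
    also have "\<dots> = integral\<^sup>L M (\<lambda>x. g (\<tau> x))"
    proof -
      have "g 1 = g 0" using g unfolding torus_continuous_def by (metis add_0)
      then have "g x = g (\<tau> x)" for x unfolding \<tau>_def by simp
      then show ?thesis by (intro Bochner_Integration.integral_cong) auto
    qed
    also have "\<dots> = integral\<^sup>L (distr M borel \<tau>) g" by (subst integral_distr) auto
    finally show ?thesis using l by simp
  qed
  ultimately show ?thesis unfolding ghost_measure_def by blast
qed

end

section \<open>Absence of atoms and singularity\<close>

lemma sin_pi_prod_nonneg:
  assumes "0 \<le> u \<and> u \<le> 1 \<and> 0 \<le> v \<and> v \<le> 1 \<or> - 1 \<le> u \<and> u \<le> 0 \<and> - 1 \<le> v \<and> v \<le> 0"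
  shows "0 \<le> sin (pi * u) * sin (pi * v)"
proof -
  have nn: "0 \<le> sin (pi * w)" if "0 \<le> w" "w \<le> 1" for w
    using that by (intro sin_ge_zero) (auto simp: mult_left_le)
  have np: "sin (pi * w) \<le> 0" if "- 1 \<le> w" "w \<le> 0" for w
    using nn[of "- w"] that by simp
  show ?thesis
    using assms nn np by (auto intro: mult_nonneg_nonneg mult_nonpos_nonpos)
qed

lemma sin_pi_prod_neg:
  assumes "0 < u" "u < 1" "- 1 < v" "v < 0"
  shows "sin (pi * u) * sin (pi * v) < 0"
proof -
  have pos: "0 < sin (pi * w)" if "0 < w" "w < 1" for w
    using that by (intro sin_gt_zero) auto
  have "0 < sin (pi * u)" "0 < sin (pi * (- v))" using pos[of u] pos[of "- v"] assms by auto
  then show ?thesis by (simp add: mult_pos_neg)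
qed

text \<open>At \<open>s = 0\<close> the sum equals \<open>k\<close> and has derivative
  \<open>ln (\<Prod>j<k. q j) < 0\<close>, so it falls below \<open>k\<close> for small positive
  \<open>s\<close>. The cap at 1 later allows \<open>w \<le> w powr s\<close> for
  \<open>w \<le> 1\<close>.\<close>

lemma exists_subunit_power_mean:
  fixes q :: "nat \<Rightarrow> real"
  assumes k: "0 < k" and q: "\<And>j. j < k \<Longrightarrow> 0 < q j" and prod: "(\<Prod>j<k. q j) < 1"
  obtains s where "0 < s" "s \<le> 1" "(\<Sum>j<k. q j powr s) < real k"
proof -
  have deriv: "((\<lambda>s. \<Sum>j<k. q j powr s) has_real_derivative (\<Sum>j<k. ln (q j))) (at 0)"
  proof (rule DERIV_sum)
    fix j assume "j \<in> {..<k}"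
    then have "0 < q j" using q by simp
    then show "((\<lambda>s. q j powr s) has_real_derivative ln (q j)) (at 0)"
      by (auto intro!: derivative_eq_intros)
  qed
  have "q j \<noteq> 0" if "j \<in> {..<k}" for j using q[of j] that by simp
  then have "(\<Sum>j<k. ln (q j)) = ln (\<Prod>j<k. q j)" by (intro ln_prod[symmetric]) auto
  also have "\<dots> < 0" using prod q by (intro ln_less_zero) (auto intro: prod_pos)
  finally obtain e where e: "0 < e" "\<And>s. 0 < s \<Longrightarrow> s < e \<Longrightarrow> (\<Sum>j<k. q j powr (0 + s)) < (\<Sum>j<k. q j powr 0)"
    using DERIV_neg_dec_right[OF deriv] by blast
  have "(\<Sum>j<k. q j powr min 1 (e / 2)) < (\<Sum>j<k. q j powr 0)"
    using e(2)[of "min 1 (e / 2)"] e(1) by simp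
  also have "\<dots> = (\<Sum>j<k. 1)"
  proof (intro sum.cong refl)
    show "q j powr 0 = 1" if "j \<in> {..<k}" for j using q[of j] that by simp
  qed
  finally show ?thesis using that[of "min 1 (e / 2)"] e(1) by simp
qed

text \<open>A zero digit matrix has norm 0, but the logarithms of the power mean need positive
  weights. A small common shift is harmless because the product depends continuously on it.\<close>

lemma exists_positive_majorant:
  fixes q :: "nat \<Rightarrow> real"
  assumes "\<And>j. j < k \<Longrightarrow> 0 \<le> q j" "(\<Prod>j<k. q j) < 1"
  obtains p where "\<And>j. j < k \<Longrightarrow> 0 < p j \<and> q j \<le> p j" "(\<Prod>j<k. p j) < 1"
proof -
  have "((\<lambda>e. \<Prod>j<k. q j + e) \<longlongrightarrow> (\<Prod>j<k. q j + 0)) (at_right 0)"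
    by (intro tendsto_intros)
  then have "\<forall>\<^sub>F e in at_right 0. (\<Prod>j<k. q j + e) < 1"
    using assms(2) by (intro order_tendstoD(2)) auto
  moreover have "\<forall>\<^sub>F e::real in at_right 0. 0 < e" by (rule eventually_at_right_less)
  ultimately have "\<forall>\<^sub>F e in at_right 0. 0 < e \<and> (\<Prod>j<k. q j + e) < 1" by eventually_elim simp
  then obtain e where "0 < e" "(\<Prod>j<k. q j + e) < 1"
    using eventually_happens'[OF trivial_limit_at_right_real] by blast
  then show ?thesis using that[of "\<lambda>j. q j + e"] assms(1) by (simp add: add_nonneg_pos)
qed

lemma prod_opnorm_less:
  fixes b :: "nat \<Rightarrow> real"
  assumes "0 < k" "\<And>j. j < k \<Longrightarrow> 0 \<le> b j" "(\<Prod>j<k. b j powr (1 / real k)) < \<rho> / real k" "0 < \<rho>"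
  shows "(\<Prod>j<k. real k / \<rho> * b j) < 1"
proof -
  have "(\<Prod>j<k. b j) = (\<Prod>j<k. (b j powr (1 / real k)) ^ k)"
  proof (intro prod.cong refl)
    fix j assume "j \<in> {..<k}"
    then have "0 \<le> b j" using assms by simp
    then show "b j = (b j powr (1 / real k)) ^ k"
      using assms(1) by (cases "b j = 0") (auto simp: powr_realpow[symmetric] powr_powr)
  qed
  also have "\<dots> = (\<Prod>j<k. b j powr (1 / real k)) ^ k" by (simp add: prod_power_distrib)
  also have "\<dots> < (\<rho> / real k) ^ k"
    using assms by (intro power_strict_mono prod_nonneg) auto
  finally have "(\<Prod>j<k. b j) < (\<rho> / real k) ^ k" .
  then have "(real k / \<rho>) ^ k * (\<Prod>j<k. b j) < (real k / \<rho>) ^ k * (\<rho> / real k) ^ k"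
    using assms by (intro mult_strict_left_mono) auto
  also have "\<dots> = 1" using assms by (simp add: power_mult_distrib[symmetric])
  finally show ?thesis by (simp only: prod.distrib prod_constant card_lessThan)
qed

context ghost_limit
begin

text \<open>The product of sines is a 1-periodic function that is negative exactly on the arc from
  \<open>a\<close> to \<open>b\<close>, so its truncated negative multiples are continuous bumps increasing to the
  indicator of that arc.\<close>

lemma arc_measure_le:
  assumes ghost: "ghost_measure k f \<mu>" and Z: "Z \<subseteq> level L"
    and outside: "\<And>M y. M \<in> level L - Z \<Longrightarrow> pos L M \<le> y \<Longrightarrow> y < pos L (Suc M) \<Longrightarrow>
      0 \<le> sin (pi * (y - a)) * sin (pi * (y - b))"
    and E: "E \<in> sets borel" and inside: "\<And>y. y \<in> E \<Longrightarrow> sin (pi * (y - a)) * sin (pi * (y - b)) < 0"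
  shows "measure \<mu> E \<le> (\<Sum>M\<in>Z. mass L M)"
proof -
  have \<mu>: "prob_space \<mu>" and sets: "sets \<mu> = sets borel"
    using ghost unfolding ghost_measure_def torus_prob_def by auto
  interpret prob_space \<mu> by (rule \<mu>)
  have E': "E \<in> sets \<mu>" using E sets by simp
  define s where "s y = - (sin (pi * (y - a)) * sin (pi * (y - b)))" for y
  define g where "g j y = min 1 (real j * max 0 (s y))" for j y
  have sc: "continuous_on UNIV s" unfolding s_def by (intro continuous_intros)
  have gc: "continuous_on UNIV (g j)" for j unfolding g_def by (intro continuous_intros sc)
  \<comment> \<open>Both sines change sign under a unit translation.\<close>
  have sper: "s (y + 1) = s y" for y
  proof -
    have "pi * (y + 1 - z) = pi * (y - z) + pi" for z by (simp add: algebra_simps)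
    then show ?thesis unfolding s_def by simp
  qed
  then have gt: "torus_continuous (g j)" for j
    unfolding torus_continuous_def using gc by (auto simp: g_def)
  have gb: "0 \<le> g j y" "g j y \<le> 1" for j y unfolding g_def by auto
  have gm: "g j \<in> borel_measurable \<mu>" for j
    using borel_measurable_continuous_onI[OF gc] measurable_cong_sets[OF sets refl] by blast
  have gi: "integrable \<mu> (g j)" for j
    using gm gb by (intro integrable_const_bound[of _ 1]) auto
  \<comment> \<open>Multiplying by the indicator of \<open>E\<close> makes the limit of the bumps
    exactly that indicator, even if the arc is larger than \<open>E\<close>.\<close>
  have gE: "integrable \<mu> (\<lambda>y. indicat_real E y * g j y)" for j
    using gb gm E' by (intro integrable_const_bound[of _ 1]) (auto simp: indicator_def)
  have le: "(\<integral>y. indicat_real E y * g j y \<partial>\<mu>) \<le> (\<Sum>M\<in>Z. mass L M)" for j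
  proof -
    have "(\<integral>y. indicat_real E y * g j y \<partial>\<mu>) \<le> (\<integral>y. g j y \<partial>\<mu>)"
      using gb by (intro integral_mono gE gi) (auto simp: indicator_def)
    also have "\<dots> \<le> (\<Sum>M\<in>Z. mass L M)"
    proof (rule ghost_integral_le[OF ghost gt gb Z])
      fix M y assume "M \<in> level L - Z" "pos L M \<le> y" "y < pos L (Suc M)"
      then have "s y \<le> 0" using outside unfolding s_def by simp
      then show "g j y = 0" by (simp add: g_def max_absorb1)
    qed
    finally show ?thesis .
  qed
  have "(\<lambda>j. \<integral>y. indicat_real E y * g j y \<partial>\<mu>) \<longlonglongrightarrow> (\<integral>y. indicat_real E y \<partial>\<mu>)"
  proof (rule integral_dominated_convergence[where w = "\<lambda>_. 1"])
    show "AE y in \<mu>. (\<lambda>j. indicat_real E y * g j y) \<longlonglongrightarrow> indicat_real E y"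
    proof (rule AE_I2)
      fix y
      show "(\<lambda>j. indicat_real E y * g j y) \<longlonglongrightarrow> indicat_real E y"
      proof (cases "y \<in> E")
        case True
        then have sp: "0 < s y" using inside unfolding s_def by simp
        obtain n where n: "1 / s y \<le> real n" using real_arch_simple by blast
        have "indicat_real E y * g j y = indicat_real E y" if "n \<le> j" for j
        proof -
          have "1 / s y \<le> real j" using n that by linarith
          then have "1 \<le> real j * s y" using sp by (simp add: field_simps)
          then show ?thesis using sp unfolding g_def by simp
        qed
        then show ?thesis
          by (intro tendsto_eventually) (auto simp: eventually_sequentially)
      qed simp
    qed
  qed (use gb gm E' in \<open>auto simp: indicator_def\<close>)
  then have "(\<lambda>j. \<integral>y. indicat_real E y * g j y \<partial>\<mu>) \<longlonglongrightarrow> measure \<mu> E" using E' by simp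
  then show ?thesis by (rule LIMSEQ_le_const2) (use le in auto)
qed

text \<open>The arc runs between the two endpoints and \<open>Z\<close> is a single index. The
  endpoints are left out because the sine product vanishes there.\<close>

lemma open_interval_measure_le:
  assumes ghost: "ghost_measure k f \<mu>" and M: "M \<in> level L"
  shows "measure \<mu> {pos L M<..<pos L (Suc M)} \<le> mass L M"
proof -
  note b = pos_level[OF M]
  have "measure \<mu> {pos L M<..<pos L (Suc M)} \<le> (\<Sum>M\<in>{M}. mass L M)"
  proof (rule arc_measure_le[OF ghost])
    fix N y assume N: "N \<in> level L - {M}" and y: "pos L N \<le> y" "y < pos L (Suc N)"
    then have "y \<le> pos L M \<or> pos L (Suc M) \<le> y"
      using pos_le_iff[of L "Suc N" M] pos_le_iff[of L "Suc M" N] by fastforce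
    then show "0 \<le> sin (pi * (y - pos L M)) * sin (pi * (y - pos L (Suc M)))"
      using b y pos_level[of N L] N pos_less_iff[of L M "Suc M"] by (intro sin_pi_prod_nonneg) auto
  next
    fix y assume "y \<in> {pos L M<..<pos L (Suc M)}"
    then show "sin (pi * (y - pos L M)) * sin (pi * (y - pos L (Suc M))) < 0"
      using b by (intro sin_pi_prod_neg) auto
  qed (use M in auto)
  then show ?thesis by simp
qed

lemma level_cover:
  assumes "0 \<le> x" "x < 1"
  obtains M where "M \<in> level L" "pos L M \<le> x" "x < pos L (Suc M)"
proof -
  \<comment> \<open>The real index whose position would be \<open>x\<close>; its floor is the wanted
    \<open>M\<close>.\<close>
  define t where "t = real k ^ L * (1 + x * (real k - 1))"
  have le: "pos L N \<le> x \<longleftrightarrow> real N \<le> t" for N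
    using k2 unfolding pos_def t_def by (simp add: field_simps)
  have t0: "0 \<le> t" using k2 assms unfolding t_def by simp
  define M where "M = nat \<lfloor>t\<rfloor>"
  have M: "real M \<le> t" "t < real (Suc M)" unfolding M_def using t0 by linarith+
  have "pos L (k ^ L) \<le> x" using assms pos_start by simp
  then have "real (k ^ L) \<le> t" using le by blast
  then have "k ^ L \<le> M" using M by linarith
  moreover have "\<not> pos L (k ^ Suc L) \<le> x" using assms pos_end by simp
  then have "\<not> real (k ^ Suc L) \<le> t" using le by blast
  then have "M < k ^ Suc L" using M(1) by linarith
  ultimately show ?thesis using that[of M] M le[of M] le[of "Suc M"] unfolding level_def by auto
qed

text \<open>A point may be an endpoint, so the arc joins its interval to the left neighbour. On the
  torus the left neighbour of the first interval is the last one.\<close>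

lemma atom_measure_le:
  assumes ghost: "ghost_measure k f \<mu>" and x: "0 \<le> x" "x < 1" and L: "1 \<le> L"
  shows "\<exists>Z\<subseteq>level L. card Z \<le> 2 \<and> measure \<mu> {x} \<le> (\<Sum>M\<in>Z. mass L M)"
proof -
  obtain M where M: "M \<in> level L" "pos L M \<le> x" "x < pos L (Suc M)" using level_cover[OF x] .
  note b = pos_level[OF M(1)]
  show ?thesis
  proof (cases "M = k ^ L")
    case False
    let ?Z = "{M - 1, M}"
    have M1: "M - 1 \<in> level L" "Suc (M - 1) = M" using False M(1) unfolding level_def by auto
    note b1 = pos_level[OF M1(1)]
    have lt: "pos L (M - 1) < pos L M" using M1(2) by (simp add: pos_less_iff)
    have "measure \<mu> {x} \<le> (\<Sum>M\<in>?Z. mass L M)"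
    proof (rule arc_measure_le[OF ghost])
      fix N y assume N: "N \<in> level L - ?Z" and y: "pos L N \<le> y" "y < pos L (Suc N)"
      then have "Suc N \<le> M - 1 \<or> Suc M \<le> N" by auto
      then have "y \<le> pos L (M - 1) \<or> pos L (Suc M) \<le> y"
        using pos_le_iff[of L "Suc N" "M - 1"] pos_le_iff[of L "Suc M" N] y by fastforce
      then show "0 \<le> sin (pi * (y - pos L (M - 1))) * sin (pi * (y - pos L (Suc M)))"
        using b b1 lt y pos_level[of N L] N pos_less_iff[of L M "Suc M"] by (intro sin_pi_prod_nonneg) auto
    next
      fix y assume "y \<in> {x}"
      then show "sin (pi * (y - pos L (M - 1))) * sin (pi * (y - pos L (Suc M))) < 0"
        using b b1 M lt x by (intro sin_pi_prod_neg) auto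
    qed (use M M1 in auto)
    then show ?thesis using M(1) M1(1) by (intro exI[of _ ?Z] conjI) (auto simp: card_insert_if)
  next
    case True
    \<comment> \<open>Wrap-around case: the arc runs from \<open>- \<delta>\<close> to
      \<open>\<delta>\<close>, where \<open>\<delta>\<close> is the interval length.\<close>
    define \<delta> where "\<delta> = 1 / (real k ^ L * (real k - 1))"
    let ?N = "k ^ Suc L - 1"
    let ?Z = "{M, ?N}"
    have SN: "Suc ?N = k ^ Suc L" using k2 by simp
    have N: "?N \<in> level L" using k2 SN unfolding level_def by (auto simp: less_Suc_eq_le[symmetric])
    have \<delta>: "pos L (Suc M) = \<delta>" "pos L ?N = 1 - \<delta>"
      using pos_width[of L M] pos_width[of L ?N] True pos_start[of L] pos_end[of L] SN unfolding \<delta>_def by auto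
    \<comment> \<open>Here \<open>1 \<le> L\<close> is used: it gives
      \<open>\<delta> \<le> 1 / 2\<close>, so that the arc does not overlap itself.\<close>
    have "2 ^ 1 * 1 \<le> real k ^ L * (real k - 1)"
    proof (rule mult_mono)
      have "(2::real) ^ 1 \<le> 2 ^ L" using L by (intro power_increasing) auto
      also have "\<dots> \<le> real k ^ L" using k2 by (intro power_mono) auto
      finally show "(2::real) ^ 1 \<le> real k ^ L" .
    qed (use k2 in auto)
    then have \<delta>2: "0 < \<delta>" "\<delta> \<le> 1 / 2" unfolding \<delta>_def by (auto simp: field_simps)
    have "measure \<mu> {x} \<le> (\<Sum>M\<in>?Z. mass L M)"
    proof (rule arc_measure_le[OF ghost])
      fix K y assume K: "K \<in> level L - ?Z" and y: "pos L K \<le> y" "y < pos L (Suc K)"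
      then have "Suc M \<le> K" "Suc K \<le> ?N" using True SN unfolding level_def by auto
      then have "\<delta> \<le> y" "y \<le> 1 - \<delta>"
        using pos_le_iff[of L "Suc M" K] pos_le_iff[of L "Suc K" ?N] y unfolding \<delta> by auto
      then show "0 \<le> sin (pi * (y - (- \<delta>))) * sin (pi * (y - \<delta>))"
        using \<delta>2 by (intro sin_pi_prod_nonneg) auto
    next
      fix y assume "y \<in> {x}"
      then show "sin (pi * (y - (- \<delta>))) * sin (pi * (y - \<delta>)) < 0"
        using M(3) \<delta> \<delta>2 x by (intro sin_pi_prod_neg) auto
    qed (use M N in auto)
    then show ?thesis using M(1) N by (intro exI[of _ ?Z] conjI) (auto simp: card_insert_if)
  qed
qed

lemma ghost_no_atoms:
  assumes ghost: "ghost_measure k f \<mu>" and r: "0 < r" "r < \<rho>"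
    and decay: "\<forall>\<^sub>F L in sequentially. \<forall>M\<in>level L. h M \<le> C * r ^ L"
  shows "emeasure \<mu> {x} = 0"
proof -
  have \<mu>: "prob_space \<mu>" and sets: "sets \<mu> = sets borel" and conc: "emeasure \<mu> (- {0..<1}) = 0"
    using ghost unfolding ghost_measure_def torus_prob_def by auto
  interpret prob_space \<mu> by (rule \<mu>)
  show ?thesis
  proof (cases "x \<in> {0..<1}")
    case True
    \<comment> \<open>The factor 2 counts the intervals around \<open>x\<close>; the absolute value
      is there because the sign of \<open>C\<close> is free.\<close>
    have "\<forall>\<^sub>F L in sequentially. measure \<mu> {x} \<le> 2 * (\<bar>C\<bar> / c) * (r / \<rho>) ^ L"
      using decay eventually_ge_at_top[of 1]
    proof eventually_elim
      case (elim L)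
      obtain Z where Z: "Z \<subseteq> level L" "card Z \<le> 2" "measure \<mu> {x} \<le> (\<Sum>M\<in>Z. mass L M)"
        using atom_measure_le[OF ghost _ _ elim(2), of x] True by auto
      have "mass L M \<le> \<bar>C\<bar> / c * (r / \<rho>) ^ L" if "M \<in> Z" for M
      proof -
        have "h M \<le> C * r ^ L" using elim Z(1) that by auto
        also have "\<dots> \<le> \<bar>C\<bar> * r ^ L" using r by (intro mult_right_mono) auto
        finally have "h M / (c * \<rho> ^ L) \<le> \<bar>C\<bar> * r ^ L / (c * \<rho> ^ L)"
          using c_pos \<rho>_pos by (intro divide_right_mono) auto
        then show ?thesis unfolding mass_def by (simp add: power_divide)
      qed
      then have "(\<Sum>M\<in>Z. mass L M) \<le> real (card Z) * (\<bar>C\<bar> / c * (r / \<rho>) ^ L)"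
        by (intro sum_bounded_above) auto
      also have "\<dots> \<le> 2 * (\<bar>C\<bar> / c * (r / \<rho>) ^ L)"
        using Z(2) r c_pos by (intro mult_right_mono) auto
      finally show ?case using Z(3) by simp
    qed
    moreover have "(\<lambda>L. 2 * (\<bar>C\<bar> / c) * (r / \<rho>) ^ L) \<longlonglongrightarrow> 2 * (\<bar>C\<bar> / c) * 0"
      using r by (intro tendsto_mult_left LIMSEQ_power_zero) auto
    ultimately have "measure \<mu> {x} \<le> 0"
      using tendsto_lowerbound[of _ 0 sequentially "measure \<mu> {x}"] by simp
    then show ?thesis by (simp add: emeasure_eq_measure measure_le_0_iff)
  next
    case False
    then have "emeasure \<mu> {x} \<le> emeasure \<mu> (- {0..<1})" using sets by (intro emeasure_mono) auto
    then show ?thesis using conc by simp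
  qed
qed

lemma measure_lborel_level_interval: "measure lborel {pos L M<..<pos L (Suc M)} = 1 / (real k ^ L * (real k - 1))"
  using pos_width[of L M] pos_less_iff[of L M "Suc M"] by simp

lemma ghost_singular:
  assumes ghost: "ghost_measure k f \<mu>"
    and q: "\<And>j. j < k \<Longrightarrow> 0 < q j" "(\<Prod>j<k. q j) < 1" and C: "0 \<le> C"
    and bound: "\<And>L M. M \<in> level L \<Longrightarrow> h M \<le> C * (\<rho> / real k) ^ L * digit_weight k q L M"
  shows "\<exists>N\<in>sets borel. emeasure lborel N = 0 \<and> emeasure \<mu> (- N) = 0"
proof -
  have \<mu>: "prob_space \<mu>" and sets: "sets \<mu> = sets borel" and conc: "emeasure \<mu> (- {0..<1}) = 0"
    using ghost unfolding ghost_measure_def torus_prob_def by auto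
  interpret prob_space \<mu> by (rule \<mu>)
  obtain s where s: "0 < s" "s \<le> 1" "(\<Sum>j<k. q j powr s) < real k"
    using exists_subunit_power_mean[of k q] q k2 by auto
  define \<theta> where "\<theta> = (\<Sum>j<k. q j powr s) / real k"
  have \<theta>: "0 \<le> \<theta>" "\<theta> < 1" unfolding \<theta>_def using s k2 by (auto intro!: divide_nonneg_nonneg sum_nonneg)
  let ?w = "digit_weight k q" and ?J = "\<lambda>L M. {pos L M<..<pos L (Suc M)}"
  \<comment> \<open>\<open>A L\<close> will be small for \<mu> and \<open>R L\<close> small for
    Lebesgue measure; together they cover all of \<open>{0..<1}\<close> except endpoints of
    generation \<open>L\<close>.\<close>
  define A where "A L = (\<Union>M\<in>{M \<in> level L. ?w L M \<le> 1}. ?J L M)" for L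
  define R where "R L = (\<Union>M\<in>{M \<in> level L. 1 < ?w L M}. ?J L M)" for L
  have w0: "0 \<le> ?w L M" for L M using q k2 by (intro digit_weight_nonneg) (auto simp: less_imp_le)
  \<comment> \<open>The factor \<open>real k - 1\<close> counts the nonzero leading digits, which
    the weight leaves out.\<close>
  have wsum: "(\<Sum>M\<in>level L. ?w L M powr s) = (real k - 1) * (real k * \<theta>) ^ L" for L
    using sum_digit_weight[of k 1 k "\<lambda>j. q j powr s" L] k2 q
    by (subst sum.cong[OF refl digit_weight_powr]) (auto simp: level_def \<theta>_def mult.commute less_imp_le)
  have measA: "A L \<in> sets borel" "R L \<in> sets borel" for L
    unfolding A_def R_def using finite_level by (auto intro!: sets.finite_UN)
  have muA: "measure \<mu> (A L) \<le> C / c * (real k - 1) * \<theta> ^ L" for L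
  proof -
    have "measure \<mu> (A L) \<le> (\<Sum>M\<in>{M \<in> level L. ?w L M \<le> 1}. measure \<mu> (?J L M))"
      unfolding A_def using finite_level sets by (intro measure_UNION_le) auto
    also have "\<dots> \<le> (\<Sum>M\<in>{M \<in> level L. ?w L M \<le> 1}. C / (c * real k ^ L) * ?w L M powr s)"
    proof (rule sum_mono)
      fix M assume M: "M \<in> {M \<in> level L. ?w L M \<le> 1}"
      have "measure \<mu> (?J L M) \<le> mass L M" using open_interval_measure_le[OF ghost] M by blast
      also have "\<dots> \<le> C * (\<rho> / real k) ^ L * ?w L M / (c * \<rho> ^ L)"
        unfolding mass_def using bound[of M L] M c_pos \<rho>_pos by (intro divide_right_mono) auto
      also have "\<dots> = C / (c * real k ^ L) * ?w L M" using \<rho>_pos by (simp add: power_divide)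
      also have "\<dots> \<le> C / (c * real k ^ L) * ?w L M powr s"
      proof (rule mult_left_mono)
        show "?w L M \<le> ?w L M powr s"
          using powr_mono'[of s 1 "?w L M"] s w0[of L M] M by (cases "?w L M = 0") auto
      qed (use C c_pos in auto)
      finally show "measure \<mu> (?J L M) \<le> C / (c * real k ^ L) * ?w L M powr s" .
    qed
    also have "\<dots> \<le> (\<Sum>M\<in>level L. C / (c * real k ^ L) * ?w L M powr s)"
      using C c_pos by (intro sum_mono2 finite_level) auto
    also have "\<dots> = C / c * (real k - 1) * \<theta> ^ L"
      unfolding sum_distrib_left[symmetric] wsum using k2 by (simp add: power_mult_distrib)
    finally show ?thesis .
  qed
  have lbR: "measure lborel (R L) \<le> \<theta> ^ L" for L
  proof -
    have "measure lborel (R L) \<le> (\<Sum>M\<in>{M \<in> level L. 1 < ?w L M}. measure lborel (?J L M))"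
      unfolding R_def using finite_level by (intro measure_UNION_le) auto
    also have "\<dots> \<le> (\<Sum>M\<in>{M \<in> level L. 1 < ?w L M}. 1 / (real k ^ L * (real k - 1)) * ?w L M powr s)"
    proof (rule sum_mono)
      fix M assume "M \<in> {M \<in> level L. 1 < ?w L M}"
      \<comment> \<open>Markov's inequality: each interval counted in \<open>R L\<close> contributes
        at least 1 to the sum of \<open>w powr s\<close>.\<close>
      then have "1 \<le> ?w L M powr s" using s by (intro ge_one_powr_ge_zero) auto
      then show "measure lborel (?J L M) \<le> 1 / (real k ^ L * (real k - 1)) * ?w L M powr s"
        unfolding measure_lborel_level_interval using k2 by (simp add: divide_right_mono)
    qed
    also have "\<dots> \<le> (\<Sum>M\<in>level L. 1 / (real k ^ L * (real k - 1)) * ?w L M powr s)"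
      using k2 by (intro sum_mono2 finite_level) auto
    also have "\<dots> = \<theta> ^ L"
      unfolding sum_distrib_left[symmetric] wsum using k2 by (simp add: power_mult_distrib)
    finally show ?thesis .
  qed
  have geo: "summable (\<lambda>L. \<theta> ^ L)" using \<theta> by (intro summable_geometric) auto
  have "summable (\<lambda>L. measure \<mu> (A L))"
    using muA by (intro summable_comparison_test'[OF summable_mult[OF geo, of "C / c * (real k - 1)"]]) auto
  then have AEA: "AE x in \<mu>. \<forall>\<^sub>F L in sequentially. x \<in> space \<mu> - A L"
    using measA sets by (intro borel_cantelli_AE1) (auto simp: less_top[symmetric])
  have "summable (\<lambda>L. measure lborel (R L))"
    using lbR by (intro summable_comparison_test'[OF geo]) auto
  moreover have "emeasure lborel (R L) < \<infinity>" for L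
  proof -
    have "emeasure lborel (R L) \<le> emeasure lborel {0..1::real}"
      unfolding R_def using pos_level by (intro emeasure_mono) fastforce+
    also have "\<dots> < \<infinity>" by simp
    finally show ?thesis .
  qed
  ultimately have AER: "AE x in lborel. \<forall>\<^sub>F L in sequentially. x \<in> space lborel - R L"
    using measA by (intro borel_cantelli_AE1) auto
  \<comment> \<open>Endpoints escape the open intervals of their generation. They are countably
    many, so \<open>N\<close> may absorb them.\<close>
  define D where "D = range (\<lambda>(L, M). pos L M)"
  have D: "countable D" unfolding D_def by simp
  define N where "N = {x. \<not> (\<forall>\<^sub>F L in sequentially. x \<notin> R L)} \<union> D"
  have "{x. \<not> (\<forall>\<^sub>F L in sequentially. x \<notin> R L)} = (\<Inter>n. \<Union>L\<in>{n..}. R L)"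
    by (auto simp: eventually_sequentially)
  then have N1: "{x. \<not> (\<forall>\<^sub>F L in sequentially. x \<notin> R L)} \<in> sets borel"
    using measA by auto
  have Dn: "D \<in> null_sets lborel" using D by (rule countable_imp_null_set_lborel)
  have "{x. \<not> (\<forall>\<^sub>F L in sequentially. x \<notin> R L)} \<in> null_sets lborel"
    using AER N1 by (subst AE_iff_null_sets) auto
  then have "N \<in> null_sets lborel" unfolding N_def using Dn by (rule null_sets.Un)
  moreover have "emeasure \<mu> (- N) = 0"
  proof -
    have "N \<in> sets borel" using null_setsD2[OF \<open>N \<in> null_sets lborel\<close>] by simp
    then have Nb: "- N \<in> sets \<mu>" unfolding sets by (rule borel_comp)
    have "AE x in \<mu>. x \<in> {0..<1}"
      using conc sets sets_eq_imp_space_eq[OF sets]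
      by (subst AE_iff_measurable[OF _ refl]) (auto simp: Compl_eq)
    with AEA have "AE x in \<mu>. x \<in> N"
    proof eventually_elim
      case (elim x)
      show "x \<in> N"
      proof (rule ccontr)
        assume x: "x \<notin> N"
        then have "\<forall>\<^sub>F L in sequentially. x \<notin> R L" "x \<notin> D" unfolding N_def by auto
        \<comment> \<open>A point of \<open>{0..<1}\<close> outside \<open>D\<close> lies in
          \<open>A L\<close> or \<open>R L\<close> for every \<open>L\<close>, yet this one
          eventually avoids both.\<close>
        from elim(1) this(1) have "\<forall>\<^sub>F L in sequentially. False"
        proof eventually_elim
          case (elim L)
          obtain M where M: "M \<in> level L" "pos L M \<le> x" "x < pos L (Suc M)"
            using level_cover[of x L] \<open>x \<in> {0..<1}\<close> by auto
          have "pos L M \<noteq> x" using \<open>x \<notin> D\<close> unfolding D_def by auto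
          then have "x \<in> ?J L M" using M by auto
          then have "x \<in> A L \<union> R L"
            unfolding A_def R_def UN_Un[symmetric] using M(1)
            by (intro UN_I[of M]) (auto simp: not_le)
          then show ?case using elim by blast
        qed
        then show False by simp
      qed
    qed
    then show ?thesis using Nb sets by (subst (asm) AE_iff_measurable[OF Nb]) (auto simp: sets_eq_imp_space_eq[OF sets])
  qed
  ultimately show ?thesis by (auto simp: null_sets_def)
qed

end

section \<open>Assembly from the digit matrices\<close>

theorem theorem8:
  fixes k d :: nat and f :: "nat \<Rightarrow> int" and F :: "nat \<Rightarrow> nat \<Rightarrow> int"
    and B :: "nat \<Rightarrow> int mat"
  assumes k: "k \<ge> 2"
    and nonneg: "\<forall>m. f m \<ge> 0"
    and regular: "k_regular k f"
    and basis: "digit_basis k f d F B"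
    and dominant: "unique_dominant_eigenvalue (cmat (digit_sum k d B))"
    and jsr: "ereal (spectral_radius (cmat (digit_sum k d B)))
                > joint_spectral_radius k d (\<lambda>a. rmat (B a))"
    and Sigma_nz: "\<forall>\<^sub>F n in sequentially. Sigma_sum k f n \<noteq> 0"
    and asymp: "\<exists>c::real. c \<noteq> 0 \<and>
       (\<lambda>n. real_of_int (Sigma_sum k f n) /
              (c * spectral_radius (cmat (digit_sum k d B)) ^ n)) \<longlonglongrightarrow> 1"
    and norm_cond: "(\<Prod>j<k. opnorm2 (rmat (B j)) powr (1 / real k))
                      < spectral_radius (cmat (digit_sum k d B)) / real k"
  shows "(\<exists>\<mu>. ghost_measure k f \<mu>) \<and>
         (\<forall>\<mu>. ghost_measure k f \<mu> \<longrightarrow> purely_singular_continuous \<mu>)"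
proof -
  let ?\<rho> = "spectral_radius (cmat (digit_sum k d B))"
  let ?b = "\<lambda>j. opnorm2 (rmat (B j))"
  have d: "0 < d" and F0: "F 0 = f" using basis unfolding digit_basis_def by auto
  interpret digit_system k d F B
    using k basis unfolding digit_basis_def by unfold_locales auto
  \<comment> \<open>The norm condition itself forces \<rho> to be positive, its left side being
    nonnegative.\<close>
  have "0 \<le> (\<Prod>j<k. ?b j powr (1 / real k))" by (intro prod_nonneg) auto
  then have "0 < ?\<rho> / real k" using norm_cond by linarith
  then have \<rho>: "0 < ?\<rho>" using k by (simp add: zero_less_divide_iff)
  obtain v where v: "v \<in> carrier_vec d"
    and lim: "\<And>M. (\<lambda>l. block_sum k f l M / ?\<rho> ^ l) \<longlonglongrightarrow> row_val M v"
    using block_sum_limit[OF d dominant \<rho>] unfolding F0 by metis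
  obtain c where c: "c \<noteq> 0" "(\<lambda>n. real_of_int (Sigma_sum k f n) / (c * ?\<rho> ^ n)) \<longlonglongrightarrow> 1"
    using asymp by blast
  then have Slim: "(\<lambda>n. real_of_int (Sigma_sum k f n) / ?\<rho> ^ n) \<longlonglongrightarrow> c"
    using tendsto_mult_left[OF c(2), of c] by simp
  have "0 \<le> Sigma_sum k f n" for n using nonneg by (simp add: Sigma_sum_def sum_nonneg)
  then have "0 \<le> c" using \<rho> by (intro LIMSEQ_le_const[OF Slim]) auto
  then have c0: "0 < c" using c by simp
  interpret ghost_limit k f ?\<rho> c "\<lambda>M. row_val M v"
    using k nonneg \<rho> c0 lim Slim by unfold_locales auto
  obtain C where C: "0 \<le> C" "\<And>L M. M < k ^ Suc L \<Longrightarrow> row_norm (M div k ^ L) \<le> C"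
    using row_norm_bound by blast
  have no_atoms: "emeasure \<mu> {x} = 0" if ghost: "ghost_measure k f \<mu>" for \<mu> x
  proof -
    obtain r where r: "0 < r" "r < ?\<rho>"
      "\<forall>\<^sub>F n in sequentially. \<forall>w. length w = n \<longrightarrow> set w \<subseteq> {..<k} \<longrightarrow>
         opnorm2 (word_prod d (\<lambda>a. rmat (B a)) w) \<le> r ^ n"
      by (rule joint_spectral_radius_lessD[OF jsr \<rho>]) (rule that)
    \<comment> \<open>An index of level \<open>L\<close> is a leading digit followed by a word of
      \<open>L\<close> digits: \<open>C\<close> bounds the row of the former, \<open>r ^ L\<close>
      the product of the latter.\<close>
    have "\<forall>\<^sub>F L in sequentially. \<forall>M\<in>level L. row_val M v \<le> C * vnorm2 v * r ^ L"
      using r(3)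
    proof eventually_elim
      case (elim L)
      show ?case
      proof
        fix M assume M: "M \<in> level L"
        let ?W = "word_prod d (\<lambda>a. rmat (B a))"
        obtain w where w: "length w = L" "set w \<subseteq> {..<k}"
          "row_val M v = row_val (M div k ^ L) (?W w *\<^sub>v v)"
          using row_val_word_prod[OF v, of L M] by blast
        have W: "?W w \<in> carrier_mat d d" using w by (intro word_prod_carrier rmat_carrier) auto
        have "row_val M v \<le> row_norm (M div k ^ L) * vnorm2 (?W w *\<^sub>v v)"
          using row_val_le[of "?W w *\<^sub>v v" "M div k ^ L"] W v w(3) by auto
        also have "\<dots> \<le> C * (opnorm2 (?W w) * vnorm2 v)"
          using M C W v unfolding level_def
          by (intro mult_mono vnorm2_mult_mat_vec_le vnorm2_nonneg) auto
        also have "\<dots> \<le> C * (r ^ L * vnorm2 v)"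
          using elim w C(1) by (intro mult_left_mono mult_right_mono vnorm2_nonneg) auto
        finally show "row_val M v \<le> C * vnorm2 v * r ^ L" by (simp add: mult_ac)
      qed
    qed
    then show ?thesis by (rule ghost_no_atoms[OF ghost r(1,2)])
  qed
  have singular: "\<exists>N\<in>sets borel. emeasure lborel N = 0 \<and> emeasure \<mu> (- N) = 0"
    if ghost: "ghost_measure k f \<mu>" for \<mu>
  proof -
    have "(\<Prod>j<k. real k / ?\<rho> * ?b j) < 1"
      using k norm_cond \<rho> by (intro prod_opnorm_less opnorm2_nonneg) auto
    then obtain q where q: "\<And>j. j < k \<Longrightarrow> 0 < q j \<and> real k / ?\<rho> * ?b j \<le> q j" "(\<Prod>j<k. q j) < 1"
      using exists_positive_majorant[of k "\<lambda>j. real k / ?\<rho> * ?b j"] \<rho> opnorm2_nonneg by auto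
    have bound: "row_val M v \<le> C * vnorm2 v * (?\<rho> / real k) ^ L * digit_weight k q L M"
      if M: "M \<in> level L" for L M
    proof -
      \<comment> \<open>Extracting \<open>?\<rho> / real k\<close> from each norm yields the factor
        \<open>(?\<rho> / real k) ^ L\<close>; against the \<open>?\<rho> ^ L\<close> in
        \<open>mass\<close> this leaves the interval length up to a constant.\<close>
      have b: "?b = (\<lambda>j. ?\<rho> / real k * (real k / ?\<rho> * ?b j))" using \<rho> k by auto
      have "digit_weight k ?b L M = (?\<rho> / real k) ^ L * digit_weight k (\<lambda>j. real k / ?\<rho> * ?b j) L M"
        by (subst b) (rule digit_weight_scale)
      also have "\<dots> \<le> (?\<rho> / real k) ^ L * digit_weight k q L M"
        using \<rho> k q opnorm2_nonneg by (intro mult_left_mono digit_weight_mono) auto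
      finally have w: "digit_weight k ?b L M \<le> (?\<rho> / real k) ^ L * digit_weight k q L M" .
      have "row_val M v \<le> row_norm (M div k ^ L) * digit_weight k ?b L M * vnorm2 v"
        using row_val_digit_weight_le[OF v, of M L] by linarith
      also have "\<dots> \<le> C * ((?\<rho> / real k) ^ L * digit_weight k q L M) * vnorm2 v"
        using M C w k unfolding level_def
        by (intro mult_right_mono mult_mono vnorm2_nonneg digit_weight_nonneg opnorm2_nonneg) auto
      finally show ?thesis by (simp add: mult_ac)
    qed
    show ?thesis
      using q C(1) vnorm2_nonneg[of v] by (intro ghost_singular[OF ghost _ _ _ bound]) auto
  qed
  show ?thesis
    using ghost_measure_exists no_atoms singular unfolding purely_singular_continuous_def by blast
qed

end
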